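(* Let $k$ be constant (with $2\le s\le k$). Assume that any randomized algorithm for PARITY-$(k,s)$-CLIQUE with error probability less than $1/3$ takes time at least $n^{\Omega(k)}$ in the worst case for hypergraphs on $n$ vertices. Then there is a small enough constant $\epsilon=\epsilon(k,s)>0$ such that if an algorithm $A$ for PARITY-$(k,s)$-CLIQUE has error probability less than $\epsilon$ on $G(n,1/2,s)$, then $A$ must have runtime $T(A,n)\ge n^{\Omega(k)}$.
   Context: An $s$-uniform hypergraph $G=(V(G),E(G))$ has hyperedge set $E(G)\subseteq\binom{V(G)}{s}$. A $k$-clique is a set $S\subset V(G)$ with $|S|=k$ and $\binom{S}{s}\subseteq E(G)$. PARITY-$(k,s)$-CLIQUE is the problem of computing the parity of the number of $k$-cliques of a given $s$-uniform hypergraph. $G(n,1/2,s)$ is the Erdős–Rényi distribution on $s$-uniform hypergraphs on $n$ vertices, in which each of the $\binom{n}{s}$ possible hyperedges is included independently with probability $1/2$. All algorithms are randomized, and each (possibly biased) coin flip has constant cost. $T(A,n)$ denotes the worst-case runtime of $A$ on $n$-vertex hypergraphs, assumed non-decreasing in $n$. Error probability on a distribution is over both the random input and the algorithm's random bits; worst-case error probability is over the algorithm's random bits only. *)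

theory Defs
  imports "HOL-Probability.Probability" "HOL-Library.Ramsey" "HOL-Library.Extended_Nat"
begin

section \<open>Randomized algorithms\<close>

text \<open>
  A randomized algorithm is a program of a probabilistic random access machine, presented in
  structured form. The memory consists of arrays of natural numbers; an array cell is addressed
  by a list of indices, so a scalar variable is an array read at the empty index list. A program
  mentions finitely many arrays and is the same for all inputs. The only arithmetic is addition
  and truncated subtraction, so that charging one time unit per elementary statement is
  polynomially equivalent to the bit cost (with unit-cost multiplication it would not be).
\<close>

datatype exp =
    Const nat
  | Read nat "exp list"
  | Add exp exp
  | Monus exp exp

text \<open>
  Guards are expressions, and count as true iff they are non-zero.
  The statement \<open>Flip x js a b\<close> tosses a coin of bias \<open>a / b\<close>, where the bias
  may be computed at run time, and stores the outcome (0 or 1) in the cell \<open>x[js]\<close>.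
\<close>

datatype com =
    Skip
  | Assign nat "exp list" exp
  | Flip nat "exp list" exp exp
  | Seq com com
  | Cond exp com com
  | While exp com

type_synonym state = "nat \<Rightarrow> nat list \<Rightarrow> nat"

fun eval :: "exp \<Rightarrow> state \<Rightarrow> nat" where
  "eval (Const m) \<sigma> = m"
| "eval (Read x js) \<sigma> = \<sigma> x (map (\<lambda>e. eval e \<sigma>) js)"
| "eval (Add a b) \<sigma> = eval a \<sigma> + eval b \<sigma>"
| "eval (Monus a b) \<sigma> = eval a \<sigma> - eval b \<sigma>"

definition store :: "state \<Rightarrow> nat \<Rightarrow> exp list \<Rightarrow> nat \<Rightarrow> state" where
  "store \<sigma> x js m = \<sigma>(x := (\<sigma> x)(map (\<lambda>e. eval e \<sigma>) js := m))"

text \<open>The bias is capped at 1, and is 0 if the denominator is 0.\<close>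

fun step :: "com \<Rightarrow> state \<Rightarrow> (com \<times> state) pmf" where
  "step Skip \<sigma> = return_pmf (Skip, \<sigma>)"
| "step (Assign x js e) \<sigma> = return_pmf (Skip, store \<sigma> x js (eval e \<sigma>))"
| "step (Flip x js a b) \<sigma> =
     map_pmf (\<lambda>r. (Skip, store \<sigma> x js (of_bool r)))
       (bernoulli_pmf (min 1 (real (eval a \<sigma>) / real (eval b \<sigma>))))"
| "step (Seq c d) \<sigma> =
     (if c = Skip then return_pmf (d, \<sigma>)
      else map_pmf (\<lambda>(c', \<sigma>'). (Seq c' d, \<sigma>')) (step c \<sigma>))"
| "step (Cond e c d) \<sigma> = return_pmf (if eval e \<sigma> \<noteq> 0 then c else d, \<sigma>)"
| "step (While e c) \<sigma> =
     return_pmf (if eval e \<sigma> \<noteq> 0 then Seq c (While e c) else Skip, \<sigma>)"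

primrec steps :: "nat \<Rightarrow> com \<times> state \<Rightarrow> (com \<times> state) pmf" where
  "steps 0 cfg = return_pmf cfg"
| "steps (Suc t) cfg = step (fst cfg) (snd cfg) \<bind> steps t"

definition halted :: "com \<times> state \<Rightarrow> bool" where
  "halted cfg \<longleftrightarrow> fst cfg = Skip"

text \<open>
  The number of steps after which the program has halted whatever the outcomes of the coin
  flips; it is \<open>\<infinity>\<close> if there is no such number.
\<close>

definition time :: "com \<Rightarrow> state \<Rightarrow> enat" where
  "time A \<sigma> = Inf (enat ` {t. \<forall>cfg\<in>set_pmf (steps t (A, \<sigma>)). halted cfg})"

text \<open>The result is delivered in the scalar variable 2.\<close>

definition outputs :: "com \<times> state \<Rightarrow> nat \<Rightarrow> bool" where
  "outputs cfg b \<longleftrightarrow> halted cfg \<and> snd cfg 2 [] = b"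

text \<open>
  The probabilities below are non-decreasing in \<open>t\<close>, since halted configurations are stationary.
\<close>

definition output_prob :: "com \<Rightarrow> state \<Rightarrow> nat \<Rightarrow> real" where
  "output_prob A \<sigma> b = (SUP t. measure_pmf.prob (steps t (A, \<sigma>)) {cfg. outputs cfg b})"


section \<open>Parity of the number of cliques in a uniform hypergraph\<close>

text \<open>
  The vertex set of an \<open>n\<close>-vertex hypergraph is \<open>{..<n}\<close>, and the hypergraph is identified
  with its set of hyperedges.
\<close>

definition hypergraphs :: "nat \<Rightarrow> nat \<Rightarrow> nat set set set" where
  "hypergraphs s n = {E. E \<subseteq> nsets {..<n} s}"

definition cliques :: "nat \<Rightarrow> nat \<Rightarrow> nat \<Rightarrow> nat set set \<Rightarrow> nat set set" where
  "cliques k s n E = {S. S \<subseteq> {..<n} \<and> card S = k \<and> nsets S s \<subseteq> E}"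

definition parity_clique :: "nat \<Rightarrow> nat \<Rightarrow> nat \<Rightarrow> nat set set \<Rightarrow> nat" where
  "parity_clique k s n E = card (cliques k s n E) mod 2"

text \<open>
  Input convention: the scalar variable 0 holds the number of vertices, array 1 is the
  \<open>s\<close>-dimensional adjacency tensor, all other cells are 0.
\<close>

definition input :: "nat \<Rightarrow> nat \<Rightarrow> nat set set \<Rightarrow> state" where
  "input s n E = (\<lambda>x js.
     if x = 0 \<and> js = [] then n
     else if x = 1 then of_bool (length js = s \<and> set js \<in> E)
     else 0)"

definition random_hypergraph :: "nat \<Rightarrow> real \<Rightarrow> nat \<Rightarrow> nat set set pmf" where
  "random_hypergraph n p s =
     map_pmf (\<lambda>f. {e \<in> nsets {..<n} s. f e})
       (Pi_pmf (nsets {..<n} s) False (\<lambda>_. bernoulli_pmf p))"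

definition runtime :: "nat \<Rightarrow> com \<Rightarrow> nat \<Rightarrow> enat" where
  "runtime s A n = (SUP E\<in>hypergraphs s n. time A (input s n E))"

text \<open>Not halting counts as an error.\<close>

definition error_prob :: "nat \<Rightarrow> nat \<Rightarrow> com \<Rightarrow> nat \<Rightarrow> nat set set \<Rightarrow> real" where
  "error_prob k s A n E = 1 - output_prob A (input s n E) (parity_clique k s n E)"

definition worst_case_error_less :: "nat \<Rightarrow> nat \<Rightarrow> com \<Rightarrow> real \<Rightarrow> bool" where
  "worst_case_error_less k s A \<delta> \<longleftrightarrow>
     (\<forall>n. \<forall>E\<in>hypergraphs s n. error_prob k s A n E < \<delta>)"

definition average_case_error_less :: "nat \<Rightarrow> nat \<Rightarrow> com \<Rightarrow> real \<Rightarrow> bool" where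
  "average_case_error_less k s A \<delta> \<longleftrightarrow>
     (\<forall>n. measure_pmf.expectation (random_hypergraph n (1/2) s) (error_prob k s A n) < \<delta>)"

definition time_at_least :: "(nat \<Rightarrow> enat) \<Rightarrow> real \<Rightarrow> bool" where
  "time_at_least T \<alpha> \<longleftrightarrow>
     (\<forall>\<^sub>F n in sequentially. ereal (real n powr \<alpha>) \<le> ereal_of_enat (T n))"

end

theory Submission
  imports Defs
begin

text \<open>
  Over the field with two elements, the parity of the number of \<open>k\<close>-cliques is a polynomial of
  degree \<open>D = k choose s\<close> in the indicators of the hyperedges, so its derivative in any \<open>D + 1\<close>
  directions vanishes. Hence for uniformly random directions \<open>y\<^sub>0, \<dots>, y\<^sub>D\<close> the value at \<open>x\<close> is
  the sum of the values at \<open>x + (\<Sum>i\<in>S. y\<^sub>i)\<close> over the nonempty sets \<open>S\<close> of directions. Each of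
  these fewer than \<open>2 ^ (D + 1)\<close> points is uniformly distributed, so an average-case algorithm \<open>A\<close>
  with error below \<open>1 / (3 * 2 ^ (D + 1))\<close> yields a worst-case algorithm with error below \<open>1/3\<close> by
  the union bound.

  Writing down the perturbed inputs costs time of order \<open>n ^ s\<close>. This is absorbed by the running time
  of \<open>A\<close>: if \<open>A\<close> inspected few hyperedges, then it would typically inspect none inside some \<open>k\<close>-set
  \<open>C\<close>. But among the inputs that differ from a given one only inside \<open>C\<close> both parities occur, so \<open>A\<close>
  would err with probability about \<open>2 ^ (- D)\<close>.
\<close>

section \<open>Runs of programs\<close>

text \<open>The hardness hypothesis covers only programs with monotone running time, so an upper
  bound on the time of the new program does not suffice: its worst-case time has to be an exact
  formula, monotone in \<open>n\<close> and in the time of \<open>A\<close>. This is why the loops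
  that prepare the inputs never branch on data, why all arithmetic on bits and indices is packed
  into expressions, and why halting times are also certified from below by single runs. Several runs
  of \<open>A\<close> must not see each other's memory, so each gets an injectively renamed copy of
  all arrays. The perturbed points share directions and are dependent, but the union bound asks only
  for the distribution of each. The one error bound \<open>1 / (3 * 2 ^ (D + 1))\<close> is used
  twice. It is a third of the reciprocal of a bound on the number of points, and it lies below
  \<open>1 / 2 ^ (D + 1)\<close>, half of the error \<open>2 ^ (- D)\<close> that is forced on an
  algorithm which inspects too little. The whole reduction then costs a constant factor, which a
  smaller exponent absorbs.\<close>

lemma steps_Skip [simp]: "steps t (Skip, \<sigma>) = return_pmf (Skip, \<sigma>)"
  by (induction t) (auto simp: bind_return_pmf)

lemma steps_0': "steps 0 = return_pmf"
  by (rule ext) simp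

lemma expectation_bind_finite:
  fixes h :: "'b \<Rightarrow> real"
  assumes "finite (set_pmf p)" "\<And>x. x \<in> set_pmf p \<Longrightarrow> finite (set_pmf (f x))"
  shows "measure_pmf.expectation (p \<bind> f) h =
    measure_pmf.expectation p (\<lambda>x. measure_pmf.expectation (f x) h)"
  using assms
  by (subst pmf_expectation_bind[of "set_pmf p"]) (auto intro: integral_measure_pmf[symmetric, where A = "set_pmf p", THEN trans] simp: integral_measure_pmf[where A = "set_pmf p"])

lemma finite_set_step: "finite (set_pmf (step c \<sigma>))"
  by (induction c) auto

lemma finite_set_steps: "finite (set_pmf (steps t cfg))"
  by (induction t arbitrary: cfg) (auto simp: set_bind_pmf finite_set_step)

lemma expectation_steps_Suc:
  "measure_pmf.expectation (steps (Suc t) (c, \<sigma>)) h =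
   measure_pmf.expectation (step c \<sigma>) (\<lambda>cfg. measure_pmf.expectation (steps t cfg) (h :: _ \<Rightarrow> real))"
  by (simp add: expectation_bind_finite finite_set_step finite_set_steps)

lemma steps_add: "steps (t + u) cfg = steps t cfg \<bind> steps u"
  by (induction t arbitrary: cfg) (auto simp: bind_return_pmf bind_assoc_pmf intro!: bind_pmf_cong)

section \<open>Halting times, bounded from above over all runs and from below by one run\<close>

definition halts_within :: "nat \<Rightarrow> com \<Rightarrow> state \<Rightarrow> bool" where
  "halts_within t c \<sigma> \<longleftrightarrow> (\<forall>cfg\<in>set_pmf (steps t (c, \<sigma>)). halted cfg)"

lemma halts_within_0 [simp]: "halts_within 0 c \<sigma> \<longleftrightarrow> c = Skip"
  by (simp add: halts_within_def halted_def)

lemma halts_within_Skip [simp]: "halts_within t Skip \<sigma>"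
  by (simp add: halts_within_def halted_def)

lemma halts_within_Suc:
  "halts_within (Suc t) c \<sigma> \<longleftrightarrow> (\<forall>(c', \<sigma>')\<in>set_pmf (step c \<sigma>). halts_within t c' \<sigma>')"
  by (auto simp: halts_within_def set_bind_pmf)

lemma steps_cong_halted:
  assumes "halts_within t c \<sigma>" "t \<le> u"
  shows "steps u (c, \<sigma>) = steps t (c, \<sigma>)"
proof -
  have "steps u (c, \<sigma>) = steps t (c, \<sigma>) \<bind> steps (u - t)"
    using assms(2) by (subst steps_add [symmetric]) simp
  also have "\<dots> = steps t (c, \<sigma>) \<bind> return_pmf"
    using assms(1) by (intro bind_pmf_cong refl) (auto simp: halts_within_def halted_def)
  finally show ?thesis by (simp add: bind_return_pmf')
qed

lemma halts_within_mono: "halts_within t c \<sigma> \<Longrightarrow> t \<le> u \<Longrightarrow> halts_within u c \<sigma>"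
  using steps_cong_halted[of t c \<sigma> u] by (simp add: halts_within_def)

lemma time_le_iff: "time c \<sigma> \<le> enat t \<longleftrightarrow> halts_within t c \<sigma>"
proof
  assume "halts_within t c \<sigma>"
  then show "time c \<sigma> \<le> enat t"
    unfolding time_def halts_within_def by (intro Inf_lower) auto
next
  assume le: "time c \<sigma> \<le> enat t"
  let ?X = "enat ` {t. \<forall>cfg\<in>set_pmf (steps t (c, \<sigma>)). halted cfg}"
  \<comment> \<open>A finite infimum excludes the empty set, and a nonempty set of extended naturals
    contains its infimum.\<close>
  have "?X \<noteq> {}" using le by (auto simp: time_def Inf_enat_def simp del: not_all split: if_splits)
  then have "Inf ?X \<in> ?X" unfolding Inf_enat_def using LeastI_ex[of "\<lambda>x. x \<in> ?X"] by auto
  then obtain u where "time c \<sigma> = enat u" "halts_within u c \<sigma>"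
    by (auto simp: time_def halts_within_def)
  then show "halts_within t c \<sigma>" using le halts_within_mono by auto
qed

text \<open>A possible run that halts after exactly \<open>t\<close> steps is a certificate that
  \<open>time\<close> is at least \<open>t\<close>. The guard \<open>c \<noteq> Skip\<close> keeps
  idle steps of a halted program from being counted.\<close>

inductive reach :: "com \<Rightarrow> state \<Rightarrow> nat \<Rightarrow> state \<Rightarrow> bool" where
  reach_Skip: "reach Skip \<sigma> 0 \<sigma>"
| reach_step: "c \<noteq> Skip \<Longrightarrow> (c', \<sigma>') \<in> set_pmf (step c \<sigma>) \<Longrightarrow> reach c' \<sigma>' t \<tau> \<Longrightarrow> reach c \<sigma> (Suc t) \<tau>"

lemma reach_not_halts: "reach c \<sigma> t \<tau> \<Longrightarrow> u < t \<Longrightarrow> \<not> halts_within u c \<sigma>"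
proof (induction arbitrary: u rule: reach.induct)
  case (reach_step c c' \<sigma>' \<sigma> t \<tau>)
  then show ?case by (cases u) (auto simp: halts_within_Suc)
qed simp

lemma reach_time: "reach c \<sigma> t \<tau> \<Longrightarrow> enat t \<le> time c \<sigma>"
proof (rule ccontr)
  assume r: "reach c \<sigma> t \<tau>" and "\<not> enat t \<le> time c \<sigma>"
  then obtain u where "time c \<sigma> \<le> enat u" "u < t" by (cases "time c \<sigma>") (auto simp: not_le)
  with reach_not_halts[OF r] show False by (simp add: time_le_iff)
qed

lemma reach_of_halts_within:
  "halts_within t c \<sigma> \<Longrightarrow> \<forall>u<t. \<not> halts_within u c \<sigma> \<Longrightarrow> \<exists>\<tau>. reach c \<sigma> t \<tau>"
proof (induction t arbitrary: c \<sigma>)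
  case 0
  then show ?case by (auto intro: reach_Skip)
next
  case (Suc t)
  have nS: "c \<noteq> Skip" using Suc.prems(2) by auto
  \<comment> \<open>Follow a slow successor: if every successor halted within \<open>t - 1\<close>
    steps, \<open>c\<close> would halt within \<open>t\<close>.\<close>
  obtain c' \<sigma>' where st: "(c', \<sigma>') \<in> set_pmf (step c \<sigma>)" and nh: "\<forall>u<t. \<not> halts_within u c' \<sigma>'"
  proof (cases t)
    case 0
    then show ?thesis using that set_pmf_not_empty[of "step c \<sigma>"] by fast
  next
    case (Suc u)
    then have "\<not> halts_within (Suc u) c \<sigma>" using Suc.prems(2) by blast
    then obtain c' \<sigma>' where *: "(c', \<sigma>') \<in> set_pmf (step c \<sigma>)" "\<not> halts_within u c' \<sigma>'"
      by (auto simp: halts_within_Suc)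
    then have "\<forall>v<t. \<not> halts_within v c' \<sigma>'" using Suc halts_within_mono by (metis less_Suc_eq_le)
    with * that show ?thesis by blast
  qed
  moreover have "halts_within t c' \<sigma>'" using st Suc.prems(1) by (auto simp: halts_within_Suc)
  ultimately show ?case using Suc.IH nS by (blast intro: reach_step)
qed

lemma reach_of_time:
  assumes "time c \<sigma> = enat t"
  shows "\<exists>\<tau>. reach c \<sigma> t \<tau>"
proof (rule reach_of_halts_within)
  show "halts_within t c \<sigma>" using assms by (simp flip: time_le_iff)
  show "\<forall>u<t. \<not> halts_within u c \<sigma>" using assms by (auto simp flip: time_le_iff)
qed

text \<open>The additional step turns \<open>Seq Skip d\<close> into \<open>d\<close>.\<close>

lemma reach_Seq: "reach c \<sigma> t \<sigma>' \<Longrightarrow> reach d \<sigma>' u \<tau> \<Longrightarrow> reach (Seq c d) \<sigma> (t + 1 + u) \<tau>"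
proof (induction rule: reach.induct)
  case (reach_Skip \<sigma>)
  then show ?case by (auto intro: reach.reach_step)
next
  case (reach_step c c' \<sigma>' \<sigma> t \<tau>')
  then have "reach (Seq c' d) \<sigma>' (t + 1 + u) \<tau>" by simp
  moreover have "(Seq c' d, \<sigma>') \<in> set_pmf (step (Seq c d) \<sigma>)"
    using reach_step by (auto intro: rev_image_eqI)
  ultimately show ?case using reach.reach_step[of "Seq c d" "Seq c' d"] by simp
qed

text \<open>Branches of \<open>c\<close> may finish at different times and start \<open>d\<close>
  early. Since \<open>d\<close> idles once it has halted, all branches look alike at time
  \<open>t + 1 + u\<close>.\<close>

lemma steps_Seq:
  assumes "halts_within t c \<sigma>" "\<forall>cfg\<in>set_pmf (steps t (c, \<sigma>)). halts_within u d (snd cfg)"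
  shows "steps (t + 1 + u) (Seq c d, \<sigma>) = steps t (c, \<sigma>) \<bind> (\<lambda>cfg. steps u (d, snd cfg))"
  using assms
proof (induction t arbitrary: c \<sigma>)
  case 0
  then show ?case by (simp add: bind_return_pmf)
next
  case (Suc t)
  show ?case
  proof (cases "c = Skip")
    case True
    with Suc.prems show ?thesis
      using steps_cong_halted[of u d \<sigma> "Suc t + u"] by (simp add: bind_return_pmf)
  next
    case False
    have "steps (Suc t + 1 + u) (Seq c d, \<sigma>) =
        step c \<sigma> \<bind> (\<lambda>(c', \<sigma>'). steps (t + 1 + u) (Seq c' d, \<sigma>'))"
      using False by (simp add: bind_map_pmf case_prod_unfold)
    also have "\<dots> = step c \<sigma> \<bind> (\<lambda>(c', \<sigma>'). steps t (c', \<sigma>') \<bind> (\<lambda>cfg. steps u (d, snd cfg)))"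
    proof (intro bind_pmf_cong refl, clarify)
      fix c' \<sigma>' assume "(c', \<sigma>') \<in> set_pmf (step c \<sigma>)"
      then have "halts_within t c' \<sigma>'" "\<forall>cfg\<in>set_pmf (steps t (c', \<sigma>')). halts_within u d (snd cfg)"
        using Suc.prems by (auto simp: halts_within_Suc)
      then show "steps (t + 1 + u) (Seq c' d, \<sigma>') = steps t (c', \<sigma>') \<bind> (\<lambda>cfg. steps u (d, snd cfg))"
        by (rule Suc.IH)
    qed
    finally show ?thesis by (simp add: bind_assoc_pmf case_prod_unfold)
  qed
qed

lemma halts_within_Seq:
  assumes "halts_within t c \<sigma>" "\<forall>cfg\<in>set_pmf (steps t (c, \<sigma>)). halts_within u d (snd cfg)"
  shows "halts_within (t + 1 + u) (Seq c d) \<sigma>"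
  using assms(2) steps_Seq[OF assms] unfolding halts_within_def by (auto simp: set_bind_pmf)

text \<open>The equation alone would survive any increase of \<open>t\<close>, because halted
  programs idle. The second conjunct provides, for every possible final state, a run of exactly
  \<open>t\<close> steps, so that exact times can be composed.\<close>

definition runs :: "com \<Rightarrow> state \<Rightarrow> nat \<Rightarrow> state pmf \<Rightarrow> bool" where
  "runs c \<sigma> t p \<longleftrightarrow> steps t (c, \<sigma>) = map_pmf (Pair Skip) p \<and> (\<forall>\<tau>\<in>set_pmf p. reach c \<sigma> t \<tau>)"

lemma runs_halts_within: "runs c \<sigma> t p \<Longrightarrow> halts_within t c \<sigma>"
  by (auto simp: runs_def halts_within_def halted_def)

lemma runs_Skip: "runs Skip \<sigma> 0 (return_pmf \<sigma>)"
  by (auto simp: runs_def intro: reach_Skip)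

lemma runs_step:
  assumes "c \<noteq> Skip" "step c \<sigma> = return_pmf (c', \<sigma>')" "runs c' \<sigma>' t p"
  shows "runs c \<sigma> (Suc t) p"
  using assms by (auto simp: runs_def bind_return_pmf intro: reach_step)

lemma runs_Assign: "runs (Assign x js e) \<sigma> 1 (return_pmf (store \<sigma> x js (eval e \<sigma>)))"
  using runs_step[OF _ _ runs_Skip] by simp

lemma runs_Flip:
  "runs (Flip x js a b) \<sigma> 1
     (map_pmf (\<lambda>r. store \<sigma> x js (of_bool r)) (bernoulli_pmf (min 1 (real (eval a \<sigma>) / real (eval b \<sigma>)))))"
  unfolding runs_def
proof (intro conjI ballI)
  fix \<tau> assume "\<tau> \<in> set_pmf (map_pmf (\<lambda>r. store \<sigma> x js (of_bool r)) (bernoulli_pmf (min 1 (real (eval a \<sigma>) / real (eval b \<sigma>)))))"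
  then have "(Skip, \<tau>) \<in> set_pmf (step (Flip x js a b) \<sigma>)" by (auto simp del: set_pmf_bernoulli)
  then show "reach (Flip x js a b) \<sigma> 1 \<tau>" using reach_step[OF _ _ reach_Skip] by simp
qed (simp add: bind_return_pmf' steps_0' pmf.map_comp o_def)

lemma runs_Seq:
  assumes "runs c \<sigma> t p" "\<And>\<tau>. \<tau> \<in> set_pmf p \<Longrightarrow> runs d \<tau> u (q \<tau>)"
  shows "runs (Seq c d) \<sigma> (t + 1 + u) (p \<bind> q)"
  unfolding runs_def
proof (intro conjI ballI)
  have p: "steps t (c, \<sigma>) = map_pmf (Pair Skip) p" using assms(1) by (simp add: runs_def)
  have "steps (t + 1 + u) (Seq c d, \<sigma>) = steps t (c, \<sigma>) \<bind> (\<lambda>cfg. steps u (d, snd cfg))"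
    using assms by (intro steps_Seq) (auto simp: p dest: runs_halts_within)
  also have "\<dots> = p \<bind> (\<lambda>\<tau>. map_pmf (Pair Skip) (q \<tau>))"
    using assms(2) by (auto simp: p bind_map_pmf runs_def intro!: bind_pmf_cong)
  finally show "steps (t + 1 + u) (Seq c d, \<sigma>) = map_pmf (Pair Skip) (p \<bind> q)"
    by (simp add: map_bind_pmf)
  fix \<tau> assume "\<tau> \<in> set_pmf (p \<bind> q)"
  with assms show "reach (Seq c d) \<sigma> (t + 1 + u) \<tau>"
    unfolding runs_def set_bind_pmf by (blast intro: reach_Seq)
qed

lemma runs_While_False: "eval e \<sigma> = 0 \<Longrightarrow> runs (While e c) \<sigma> 1 (return_pmf \<sigma>)"
  using runs_step[OF _ _ runs_Skip] by simp

lemma runs_While_True: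
  "eval e \<sigma> \<noteq> 0 \<Longrightarrow> runs (Seq c (While e c)) \<sigma> t p \<Longrightarrow> runs (While e c) \<sigma> (Suc t) p"
  using runs_step[of "While e c"] by simp

lemma output_prob_ge: "measure_pmf.prob (steps t (c, \<sigma>)) {cfg. outputs cfg b} \<le> output_prob c \<sigma> b"
  unfolding output_prob_def by (rule cSUP_upper) (auto intro: bdd_aboveI[of _ 1])

lemma outputs_prob_mono:
  assumes "t \<le> u"
  shows "measure_pmf.prob (steps t cfg) {cfg. outputs cfg b} \<le> measure_pmf.prob (steps u cfg) {cfg. outputs cfg b}"
proof -
  let ?S = "{cfg. outputs cfg b}"
  have st: "steps (u - t) c = return_pmf c" if "outputs c b" for c
    using that by (cases c) (auto simp: outputs_def halted_def)
  have "measure_pmf.prob (steps t cfg) ?S = measure_pmf.expectation (steps t cfg) (indicator ?S)"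
    by simp
  also have "\<dots> \<le> measure_pmf.expectation (steps t cfg) (\<lambda>c. measure_pmf.prob (steps (u - t) c) ?S)"
    by (intro integral_mono measure_pmf.integrable_const_bound[where B = 1])
       (auto simp: indicator_def st measure_return)
  also have "\<dots> = measure_pmf.expectation (steps t cfg \<bind> steps (u - t)) (indicator ?S)"
    by (subst expectation_bind_finite) (simp_all add: finite_set_steps)
  also have "\<dots> = measure_pmf.prob (steps t cfg \<bind> steps (u - t)) ?S"
    by simp
  finally show ?thesis using assms by (simp flip: steps_add)
qed

lemma output_prob_eq:
  assumes "halts_within T c \<sigma>"
  shows "output_prob c \<sigma> b = measure_pmf.prob (steps T (c, \<sigma>)) {cfg. outputs cfg b}"
proof (rule antisym)
  show "output_prob c \<sigma> b \<le> measure_pmf.prob (steps T (c, \<sigma>)) {cfg. outputs cfg b}"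
    unfolding output_prob_def
  proof (rule cSUP_least)
    fix t
    show "measure_pmf.prob (steps t (c, \<sigma>)) {cfg. outputs cfg b} \<le> measure_pmf.prob (steps T (c, \<sigma>)) {cfg. outputs cfg b}"
      using outputs_prob_mono[of t T] steps_cong_halted[OF assms, of t] by (cases "t \<le> T") auto
  qed simp
qed (rule output_prob_ge)

section \<open>Renaming arrays\<close>

fun rename_exp :: "(nat \<Rightarrow> nat) \<Rightarrow> exp \<Rightarrow> exp" where
  "rename_exp f (Const m) = Const m"
| "rename_exp f (Read x js) = Read (f x) (map (rename_exp f) js)"
| "rename_exp f (Add a b) = Add (rename_exp f a) (rename_exp f b)"
| "rename_exp f (Monus a b) = Monus (rename_exp f a) (rename_exp f b)"

primrec rename :: "(nat \<Rightarrow> nat) \<Rightarrow> com \<Rightarrow> com" where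
  "rename f Skip = Skip"
| "rename f (Assign x js e) = Assign (f x) (map (rename_exp f) js) (rename_exp f e)"
| "rename f (Flip x js a b) = Flip (f x) (map (rename_exp f) js) (rename_exp f a) (rename_exp f b)"
| "rename f (Seq c d) = Seq (rename f c) (rename f d)"
| "rename f (Cond e c d) = Cond (rename_exp f e) (rename f c) (rename f d)"
| "rename f (While e c) = While (rename_exp f e) (rename f c)"

text \<open>Arrays in the range of \<open>f\<close> carry the memory \<open>\<tau>\<close> of the
  renamed program, all others carry the frame \<open>\<sigma>\<close>. For injective
  \<open>f\<close> every step commutes with \<open>embed f \<sigma>\<close>, so a renamed run is the
  image of the original one and leaves the frame intact.\<close>

definition embed :: "(nat \<Rightarrow> nat) \<Rightarrow> state \<Rightarrow> state \<Rightarrow> state" where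
  "embed f \<sigma> \<tau> = (\<lambda>x. if x \<in> range f then \<tau> (inv f x) else \<sigma> x)"

lemma embed_comp: "inj f \<Longrightarrow> embed f \<sigma> \<tau> \<circ> f = \<tau>"
  by (auto simp: embed_def fun_eq_iff)

lemma embed_self: "inj f \<Longrightarrow> embed f \<sigma> (\<sigma> \<circ> f) = \<sigma>"
  by (auto simp: embed_def fun_eq_iff)

lemma eval_rename_exp: "eval (rename_exp f e) \<sigma> = eval e (\<sigma> \<circ> f)"
  by (induction e "\<sigma> \<circ> f" rule: eval.induct) (auto simp: o_def cong: map_cong)

lemma eval_rename_embed: "inj f \<Longrightarrow> eval (rename_exp f e) (embed f \<sigma> \<tau>) = eval e \<tau>"
  by (simp add: eval_rename_exp embed_comp)

lemma store_embed:
  "inj f \<Longrightarrow> store (embed f \<sigma> \<tau>) (f x) (map (rename_exp f) js) m = embed f \<sigma> (store \<tau> x js m)"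
  by (auto simp: store_def eval_rename_embed o_def) (auto simp: embed_def fun_eq_iff inj_eq)

lemma rename_eq_Skip [simp]: "rename f c = Skip \<longleftrightarrow> c = Skip"
  by (cases c) auto

lemma step_rename:
  "inj f \<Longrightarrow> step (rename f c) (embed f \<sigma> \<tau>) =
     map_pmf (\<lambda>(c', \<tau>'). (rename f c', embed f \<sigma> \<tau>')) (step c \<tau>)"
  by (induction c)
     (auto simp: store_embed eval_rename_embed pmf.map_comp o_def case_prod_unfold)

lemma steps_rename:
  "inj f \<Longrightarrow> steps t (rename f c, embed f \<sigma> \<tau>) =
     map_pmf (\<lambda>(c', \<tau>'). (rename f c', embed f \<sigma> \<tau>')) (steps t (c, \<tau>))"
  by (induction t arbitrary: c \<tau>)
     (auto simp: step_rename bind_map_pmf map_bind_pmf case_prod_unfold intro!: bind_pmf_cong)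

lemma halts_within_rename:
  "inj f \<Longrightarrow> halts_within t c (\<sigma> \<circ> f) \<Longrightarrow> halts_within t (rename f c) \<sigma>"
  using steps_rename[of f t c \<sigma> "\<sigma> \<circ> f"]
  by (auto simp: embed_self halts_within_def halted_def)

lemma reach_rename:
  assumes "inj f"
  shows "reach c \<tau> t \<tau>' \<Longrightarrow> reach (rename f c) (embed f \<sigma> \<tau>) t (embed f \<sigma> \<tau>')"
proof (induction rule: reach.induct)
  case (reach_step c c' \<tau>' \<tau> t \<tau>'')
  have "(rename f c', embed f \<sigma> \<tau>') \<in> set_pmf (step (rename f c) (embed f \<sigma> \<tau>))"
    using reach_step by (force simp: step_rename[OF assms])
  then show ?case using reach_step reach.reach_step by simp
qed (simp add: reach.reach_Skip)

section \<open>Sampling the perturbed inputs\<close>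

definition xor_exp :: "exp \<Rightarrow> exp \<Rightarrow> exp" where
  "xor_exp a b = Add (Monus a b) (Monus b a)"

definition xor_nat :: "nat \<Rightarrow> nat \<Rightarrow> nat" where
  "xor_nat a b = (a - b) + (b - a)"

definition and_exp :: "exp \<Rightarrow> exp \<Rightarrow> exp" where
  "and_exp a b = Monus a (Monus (Const 1) b)"

definition less_exp :: "exp \<Rightarrow> exp \<Rightarrow> exp" where
  "less_exp a b = Monus (Const 1) (Monus (Const 1) (Monus b a))"

text \<open>\<open>Monus e (Monus e f)\<close> is the minimum of \<open>e\<close> and
  \<open>f\<close>, and \<open>Add e (Monus f e)\<close> is the maximum. Sorting an index list thus
  becomes an expression without branching, evaluated within a single step whatever the indices
  are.\<close>

primrec insort_exp :: "exp \<Rightarrow> exp list \<Rightarrow> exp list" where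
  "insort_exp e [] = [e]"
| "insort_exp e (f # fs) = Monus e (Monus e f) # insort_exp (Add e (Monus f e)) fs"

primrec sort_exp :: "exp list \<Rightarrow> exp list" where
  "sort_exp [] = []"
| "sort_exp (e # es) = insort_exp e (sort_exp es)"

fun strict_exp :: "exp list \<Rightarrow> exp" where
  "strict_exp (e # f # es) = and_exp (less_exp e f) (strict_exp (f # es))"
| "strict_exp _ = Const 1"

definition xor_list_exp :: "exp list \<Rightarrow> exp" where
  "xor_list_exp es = foldr xor_exp es (Const 0)"

lemma eval_xor_exp [simp]: "eval (xor_exp a b) \<sigma> = xor_nat (eval a \<sigma>) (eval b \<sigma>)"
  by (simp add: xor_exp_def xor_nat_def)

lemma xor_nat_of_bool [simp]: "xor_nat (of_bool p) (of_bool q) = of_bool (p \<noteq> q)"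
  by (auto simp: xor_nat_def)

lemma eval_and_exp: "eval (and_exp a b) \<sigma> = eval a \<sigma> - (1 - eval b \<sigma>)"
  by (simp add: and_exp_def)

lemma eval_less_exp: "eval (less_exp a b) \<sigma> = of_bool (eval a \<sigma> < eval b \<sigma>)"
  by (auto simp: less_exp_def)

lemma eval_insort_exp:
  "sorted (map (\<lambda>e. eval e \<sigma>) es) \<Longrightarrow>
   map (\<lambda>e. eval e \<sigma>) (insort_exp e es) = insort (eval e \<sigma>) (map (\<lambda>e. eval e \<sigma>) es)"
proof (induction es arbitrary: e)
  case (Cons f fs)
  show ?case
  proof (cases "eval e \<sigma> \<le> eval f \<sigma>")
    case True
    then show ?thesis
      using Cons.prems Cons.IH[of "Add e (Monus f e)"] by (simp add: insort_is_Cons)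
  next
    case False
    then show ?thesis using Cons by auto
  qed
qed simp

lemma eval_sort_exp: "map (\<lambda>e. eval e \<sigma>) (sort_exp es) = sort (map (\<lambda>e. eval e \<sigma>) es)"
  by (induction es) (simp_all add: eval_insort_exp)

lemma eval_strict_exp: "eval (strict_exp es) \<sigma> = of_bool (sorted_wrt (<) (map (\<lambda>e. eval e \<sigma>) es))"
proof (induction es rule: strict_exp.induct)
  case (1 e f es)
  then show ?case by (auto simp: eval_and_exp eval_less_exp)
qed auto

lemma eval_strict_sort_exp: "eval (strict_exp (sort_exp es)) \<sigma> = of_bool (distinct (map (\<lambda>e. eval e \<sigma>) es))"
  by (simp only: eval_strict_exp eval_sort_exp strict_sorted_iff sorted_sort distinct_sort) simp

lemma eval_xor_list_exp: "eval (xor_list_exp es) \<sigma> = foldr xor_nat (map (\<lambda>e. eval e \<sigma>) es) 0"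
  by (induction es) (auto simp: xor_list_exp_def)

lemma foldr_xor_nat: "foldr xor_nat (map (\<lambda>i. of_bool (P i)) is) 0 = of_bool (odd (length (filter P is)))"
  by (induction "is") auto

text \<open>
  \<open>nest m b\<close> runs \<open>b\<close> for all vertices as values of the loop variables \<open>3, \<dots>, 3 + m - 1\<close>. Each loop
  resets its variable to the initial value 0, so that the effect of the nest on the state is exactly
  the composition of the effects of \<open>b\<close>.
\<close>

primrec nest :: "nat \<Rightarrow> com \<Rightarrow> com" where
  "nest 0 b = b"
| "nest (Suc m) b =
     Seq (While (Monus (Read 0 []) (Read (3 + m) []))
           (Seq (nest m b) (Assign (3 + m) [] (Add (Read (3 + m) []) (Const 1)))))
         (Assign (3 + m) [] (Const 0))"

text \<open>An iteration pays 4 on top of the inner nest: the guard, the increment and two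
  sequencing steps. The final 3 are the failing guard, a sequencing step and the reset of the
  counter.\<close>

primrec nest_time :: "nat \<Rightarrow> nat \<Rightarrow> nat \<Rightarrow> nat" where
  "nest_time T n 0 = T"
| "nest_time T n (Suc m) = n * (nest_time T n m + 4) + 3"

definition tuples :: "nat \<Rightarrow> nat \<Rightarrow> nat \<Rightarrow> (nat \<Rightarrow> nat) \<Rightarrow> nat list set" where
  "tuples s n m v = {js. length js = s \<and> (\<forall>i<s. if i < m then js ! i < n else js ! i = v i)}"

text \<open>What is left for loop \<open>m\<close> when its counter stands at \<open>a\<close>: the
  coordinates of the inner loops are still free, those of the outer loops are frozen at their
  counters.\<close>

definition tuples_from :: "nat \<Rightarrow> nat \<Rightarrow> nat \<Rightarrow> nat \<Rightarrow> (nat \<Rightarrow> nat) \<Rightarrow> nat list set" where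
  "tuples_from s n m a v = {js. length js = s \<and>
     (\<forall>i<s. if i < m then js ! i < n else if i = m then a \<le> js ! i \<and> js ! i < n else js ! i = v i)}"

lemma finite_bounded_lists:
  assumes "\<And>js. js \<in> A \<Longrightarrow> length js = s \<and> (\<forall>i<s. js ! i < f i)"
  shows "finite (A :: nat list set)"
proof (rule finite_subset)
  show "A \<subseteq> {js. set js \<subseteq> (\<Union>i<s. {..<f i}) \<and> length js = s}"
    using assms by (fastforce simp: in_set_conv_nth)
  show "finite {js. set js \<subseteq> (\<Union>i<s. {..<f i}) \<and> length js = s}"
    by (rule finite_lists_length_eq) auto
qed

lemma finite_tuples: "finite (tuples s n m v)"
proof (rule finite_bounded_lists[of _ s "\<lambda>i. n + Suc (v i)"])
  fix js assume js: "js \<in> tuples s n m v"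
  have "js ! i < n + Suc (v i)" if "i < s" for i
    using js that by (cases "i < m") (auto simp: tuples_def)
  then show "length js = s \<and> (\<forall>i<s. js ! i < n + Suc (v i))"
    using js by (simp add: tuples_def)
qed

lemma finite_tuples_from: "finite (tuples_from s n m a v)"
proof (rule finite_bounded_lists[of _ s "\<lambda>i. n + Suc (v i)"])
  fix js assume js: "js \<in> tuples_from s n m a v"
  have "js ! i < n + Suc (v i)" if "i < s" for i
    using js that by (cases i m rule: linorder_cases) (auto simp: tuples_from_def)
  then show "length js = s \<and> (\<forall>i<s. js ! i < n + Suc (v i))"
    using js by (simp add: tuples_from_def)
qed

lemma tuples_0: "tuples s n 0 v = {map v [0..<s]}"
  by (auto simp: tuples_def intro: nth_equalityI)

lemma tuples_from_split:
  assumes "m < s" "v m < n"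
  shows "tuples_from s n m (v m) v = tuples s n m v \<union> tuples_from s n m (Suc (v m)) v"
    and "tuples s n m v \<inter> tuples_from s n m (Suc (v m)) v = {}"
proof -
  let ?P = "\<lambda>i x. if i < m then x < n else if i = m then v m \<le> x \<and> x < n else x = v i"
  let ?Q = "\<lambda>i x. if i < m then x < n else x = v i"
  let ?R = "\<lambda>i x. if i < m then x < n else if i = m then Suc (v m) \<le> x \<and> x < n else x = v i"
  have "(\<forall>i<s. ?P i (f i)) \<longleftrightarrow> (\<forall>i<s. ?Q i (f i)) \<or> (\<forall>i<s. ?R i (f i))" (is "?l \<longleftrightarrow> ?r1 \<or> ?r2")
    for f :: "nat \<Rightarrow> nat"
  proof (cases "f m = v m")
    case True
    then have "?P i (f i) \<longleftrightarrow> ?Q i (f i)" for i using assms by auto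
    then have l: "?l \<longleftrightarrow> ?r1" by (simp only:)
    have r: "\<not> ?r2" using True assms by auto
    show ?thesis by (simp only: l r simp_thms)
  next
    case False
    then have "?P i (f i) \<longleftrightarrow> ?R i (f i)" for i by auto
    then have l: "?l \<longleftrightarrow> ?r2" by (simp only:)
    have r: "\<not> ?r1" using False assms by auto
    show ?thesis by (simp only: l r simp_thms)
  qed
  from this[of "(!) js" for js]
  show "tuples_from s n m (v m) v = tuples s n m v \<union> tuples_from s n m (Suc (v m)) v"
    unfolding tuples_def tuples_from_def by blast
  show "tuples s n m v \<inter> tuples_from s n m (Suc (v m)) v = {}"
    using assms by (force simp: tuples_def tuples_from_def)
qed

lemma tuples_from_0: "tuples_from s n m 0 v = tuples s n (Suc m) v"
proof -
  have "(if i < m then x < n else if i = m then 0 \<le> x \<and> x < n else x = v i) \<longleftrightarrow>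
    (if i < Suc m then x < n else x = v i)" for i x
    by auto
  then show ?thesis unfolding tuples_def tuples_from_def by presburger
qed

lemma tuples_from_empty: "m < s \<Longrightarrow> n \<le> a \<Longrightarrow> tuples_from s n m a v = {}"
  by (force simp: tuples_from_def)

text \<open>\<open>K C\<close> is the total effect of the body on the index lists in
  \<open>C\<close>. It is kept abstract because one nest tosses coins and another computes
  deterministically. The assumptions say that effects on disjoint sets compose, commute with changes
  of the loop counters and do not alter them; hence only the set of visited lists matters.\<close>

lemma runs_nest:
  fixes K :: "nat list set \<Rightarrow> state \<Rightarrow> state pmf"
  assumes K0: "\<And>\<sigma>. K {} \<sigma> = return_pmf \<sigma>"
    and KU: "\<And>C C' \<sigma>. finite C \<Longrightarrow> finite C' \<Longrightarrow> C \<inter> C' = {} \<Longrightarrow> K (C \<union> C') \<sigma> = K C \<sigma> \<bind> K C'"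
    and Kupd: "\<And>C \<sigma> i f. i < s \<Longrightarrow> K C (\<sigma>(3 + i := f)) = map_pmf (\<lambda>\<tau>. \<tau>(3 + i := f)) (K C \<sigma>)"
    and Kpres: "\<And>C \<sigma> \<tau> x. \<tau> \<in> set_pmf (K C \<sigma>) \<Longrightarrow> x < 3 + s \<Longrightarrow> \<tau> x = \<sigma> x"
    and body: "\<And>\<sigma>. runs b \<sigma> T (K {map (\<lambda>i. \<sigma> (3 + i) []) [0..<s]} \<sigma>)"
  shows "m \<le> s \<Longrightarrow> (\<forall>i<m. \<sigma> (3 + i) [] = 0) \<Longrightarrow> \<sigma> 0 [] = n \<Longrightarrow>
    runs (nest m b) \<sigma> (nest_time T n m) (K (tuples s n m (\<lambda>i. \<sigma> (3 + i) [])) \<sigma>)"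
proof (induction m arbitrary: \<sigma>)
  case 0
  then show ?case by (simp add: tuples_0 body)
next
  case (Suc m)
  let ?e = "Monus (Read 0 []) (Read (3 + m) [])"
  let ?c = "Seq (nest m b) (Assign (3 + m) [] (Add (Read (3 + m) []) (Const 1)))"
  let ?L = "nest_time T n m"
  note nest = Suc.IH
  have ms: "m < s" using Suc.prems(1) by simp
  \<comment> \<open>Induction on the number \<open>k\<close> of remaining iterations; the loop
    leaves its counter at \<open>n\<close>, whence the update in the result.\<close>
  have while: "runs (While ?e ?c) \<sigma> (k * (?L + 4) + 1)
      (map_pmf (\<lambda>\<tau>. \<tau>(3 + m := (\<sigma> (3 + m))([] := n)))
        (K (tuples_from s n m (\<sigma> (3 + m) []) (\<lambda>i. \<sigma> (3 + i) [])) \<sigma>))"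
    if "\<forall>i<m. \<sigma> (3 + i) [] = 0" "\<sigma> 0 [] = n" "\<sigma> (3 + m) [] + k = n" for k \<sigma>
    using that
  proof (induction k arbitrary: \<sigma>)
    case 0
    then have "\<sigma>(3 + m := (\<sigma> (3 + m))([] := n)) = \<sigma>" by (auto simp: fun_eq_iff)
    then show ?case using 0 ms runs_While_False[of ?e \<sigma> ?c]
      by (simp add: tuples_from_empty K0 del: fun_upd_apply)
  next
    case (Suc k)
    let ?v = "\<lambda>i. \<sigma> (3 + i) []" and ?a = "\<sigma> (3 + m) []"
    define u where "u \<tau> = \<tau>(3 + m := (\<sigma> (3 + m))([] := Suc ?a))" for \<tau> :: state
    have ke: "eval ?e \<sigma> \<noteq> 0" using Suc.prems by simp
    have pres: "\<tau> x = \<sigma> x" if "\<tau> \<in> set_pmf (K (tuples s n m ?v) \<sigma>)" "x < 3 + s" for \<tau> x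
      using Kpres that by blast
    have "runs ?c \<sigma> (?L + 1 + 1) (K (tuples s n m ?v) \<sigma> \<bind> (\<lambda>\<tau>. return_pmf (u \<tau>)))"
    proof (rule runs_Seq)
      show "runs (nest m b) \<sigma> ?L (K (tuples s n m ?v) \<sigma>)"
        using Suc.prems ms by (intro nest) auto
      fix \<tau> assume "\<tau> \<in> set_pmf (K (tuples s n m ?v) \<sigma>)"
      then have "\<tau> (3 + m) = \<sigma> (3 + m)" using ms pres by simp
      then have "store \<tau> (3 + m) [] (eval (Add (Read (3 + m) []) (Const 1)) \<tau>) = u \<tau>"
        by (simp add: store_def u_def)
      then show "runs (Assign (3 + m) [] (Add (Read (3 + m) []) (Const 1))) \<tau> 1 (return_pmf (u \<tau>))"
        using runs_Assign by metis
    qed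
    then have "runs (Seq ?c (While ?e ?c)) \<sigma> (?L + 1 + 1 + 1 + (k * (?L + 4) + 1))
       ((K (tuples s n m ?v) \<sigma> \<bind> (\<lambda>\<tau>. return_pmf (u \<tau>))) \<bind>
         (\<lambda>\<tau>. map_pmf (\<lambda>\<rho>. \<rho>(3 + m := (\<tau> (3 + m))([] := n)))
            (K (tuples_from s n m (\<tau> (3 + m) []) (\<lambda>i. \<tau> (3 + i) [])) \<tau>)))"
    proof (rule runs_Seq)
      fix \<tau>' assume "\<tau>' \<in> set_pmf (K (tuples s n m ?v) \<sigma> \<bind> (\<lambda>\<tau>. return_pmf (u \<tau>)))"
      then obtain \<tau> where t: "\<tau> \<in> set_pmf (K (tuples s n m ?v) \<sigma>)" "\<tau>' = u \<tau>"
        by (auto simp: set_bind_pmf)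
      have "\<tau>' x = \<sigma> x" if "x < 3 + s" "x \<noteq> 3 + m" for x
        using that t pres by (simp add: u_def)
      then show "runs (While ?e ?c) \<tau>' (k * (?L + 4) + 1)
          (map_pmf (\<lambda>\<rho>. \<rho>(3 + m := (\<tau>' (3 + m))([] := n)))
            (K (tuples_from s n m (\<tau>' (3 + m) []) (\<lambda>i. \<tau>' (3 + i) [])) \<tau>'))"
        using Suc.prems ms by (intro Suc.IH) (auto simp: t u_def)
    qed
    also have "(K (tuples s n m ?v) \<sigma> \<bind> (\<lambda>\<tau>. return_pmf (u \<tau>))) \<bind>
         (\<lambda>\<tau>. map_pmf (\<lambda>\<rho>. \<rho>(3 + m := (\<tau> (3 + m))([] := n)))
            (K (tuples_from s n m (\<tau> (3 + m) []) (\<lambda>i. \<tau> (3 + i) [])) \<tau>)) =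
       K (tuples s n m ?v) \<sigma> \<bind> (\<lambda>\<tau>. map_pmf (\<lambda>\<rho>. \<rho>(3 + m := (\<sigma> (3 + m))([] := n)))
            (K (tuples_from s n m (Suc ?a) ?v) \<tau>))"
      unfolding bind_assoc_pmf bind_return_pmf
    proof (intro bind_pmf_cong refl)
      fix \<tau> assume t: "\<tau> \<in> set_pmf (K (tuples s n m ?v) \<sigma>)"
      have "tuples_from s n m (u \<tau> (3 + m) []) (\<lambda>i. u \<tau> (3 + i) []) = tuples_from s n m (Suc ?a) ?v"
        unfolding tuples_from_def using pres[OF t] by (auto simp: u_def)
      moreover have "K C (u \<tau>) = map_pmf u (K C \<tau>)" for C
        unfolding u_def using ms by (rule Kupd)
      ultimately show "map_pmf (\<lambda>\<rho>. \<rho>(3 + m := (u \<tau> (3 + m))([] := n)))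
            (K (tuples_from s n m (u \<tau> (3 + m) []) (\<lambda>i. u \<tau> (3 + i) [])) (u \<tau>)) =
          map_pmf (\<lambda>\<rho>. \<rho>(3 + m := (\<sigma> (3 + m))([] := n))) (K (tuples_from s n m (Suc ?a) ?v) \<tau>)"
        by (simp add: pmf.map_comp o_def u_def)
    qed
    also have "\<dots> = map_pmf (\<lambda>\<rho>. \<rho>(3 + m := (\<sigma> (3 + m))([] := n))) (K (tuples_from s n m ?a ?v) \<sigma>)"
      using tuples_from_split[of m s ?v n] ms Suc.prems
      by (simp add: KU finite_tuples finite_tuples_from map_bind_pmf)
    finally have run: "runs (Seq ?c (While ?e ?c)) \<sigma> (?L + 1 + 1 + 1 + (k * (?L + 4) + 1))
       (map_pmf (\<lambda>\<rho>. \<rho>(3 + m := (\<sigma> (3 + m))([] := n))) (K (tuples_from s n m ?a ?v) \<sigma>))" .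
    have "Suc (?L + 1 + 1 + 1 + (k * (?L + 4) + 1)) = Suc k * (?L + 4) + 1"
      by (simp add: algebra_simps)
    with runs_While_True[OF ke run] show ?case by (simp only:)
  qed
  let ?v = "\<lambda>i. \<sigma> (3 + i) []"
  have "\<sigma> (3 + m) [] + n = n" using Suc.prems by simp
  then have "runs (nest (Suc m) b) \<sigma> (n * (?L + 4) + 1 + 1 + 1)
      ((map_pmf (\<lambda>\<tau>. \<tau>(3 + m := (\<sigma> (3 + m))([] := n))) (K (tuples_from s n m (\<sigma> (3 + m) []) ?v) \<sigma>)) \<bind>
        (\<lambda>\<tau>. return_pmf (store \<tau> (3 + m) [] (eval (Const 0) \<tau>))))"
    unfolding nest.simps using Suc.prems
    by (intro runs_Seq while runs_Assign) auto
  also have "map_pmf (\<lambda>\<tau>. \<tau>(3 + m := (\<sigma> (3 + m))([] := n))) (K (tuples_from s n m (\<sigma> (3 + m) []) ?v) \<sigma>) \<bind>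
        (\<lambda>\<tau>. return_pmf (store \<tau> (3 + m) [] (eval (Const 0) \<tau>))) =
      K (tuples_from s n m (\<sigma> (3 + m) []) ?v) \<sigma> \<bind> (\<lambda>\<tau>. return_pmf \<tau>)"
    unfolding bind_map_pmf
  proof (intro bind_pmf_cong refl arg_cong[where f = return_pmf])
    fix \<tau> assume "\<tau> \<in> set_pmf (K (tuples_from s n m (\<sigma> (3 + m) []) ?v) \<sigma>)"
    then have "\<tau> (3 + m) = \<sigma> (3 + m)" using ms Kpres by simp
    moreover have "\<sigma> (3 + m) [] = 0" using Suc.prems by simp
    ultimately show "store (\<tau>(3 + m := (\<sigma> (3 + m))([] := n))) (3 + m) [] (eval (Const 0) (\<tau>(3 + m := (\<sigma> (3 + m))([] := n)))) = \<tau>"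
      by (simp add: store_def fun_eq_iff)
  qed
  also have "\<dots> = K (tuples s n (Suc m) ?v) \<sigma>"
    using Suc.prems by (simp add: bind_return_pmf' tuples_from_0)
  finally show ?case by (simp add: numeral_3_eq_3)
qed

section \<open>Sampling the random directions\<close>

definition vars :: "nat \<Rightarrow> exp list" where
  "vars s = map (\<lambda>i. Read (3 + i) []) [0..<s]"

lemma eval_vars: "map (\<lambda>e. eval e \<sigma>) (vars s) = map (\<lambda>i. \<sigma> (3 + i) []) [0..<s]"
  by (simp add: vars_def)

lemma vars_cong: "(\<And>x. x < 3 + s \<Longrightarrow> \<sigma> x = \<tau> x) \<Longrightarrow>
    map (\<lambda>i. \<sigma> (3 + i) []) [0..<s] = map (\<lambda>i. \<tau> (3 + i) []) [0..<s]"
  by simp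

text \<open>Array \<open>3 + s + i\<close> holds direction \<open>i\<close>. Every word of length
  \<open>s\<close> receives a bit, so that the number of steps is the same for all words; the bits
  at strictly increasing words are the values of the direction on the hyperedges.\<close>

primrec flips :: "nat \<Rightarrow> nat \<Rightarrow> com" where
  "flips s 0 = Skip"
| "flips s (Suc i) = Seq (flips s i) (Flip (3 + s + i) (vars s) (Const 1) (Const 2))"

definition overlay :: "nat \<Rightarrow> (nat \<times> nat list) set \<Rightarrow> (nat \<times> nat list \<Rightarrow> bool) \<Rightarrow> state \<Rightarrow> state" where
  "overlay r Z w \<sigma> = (\<lambda>x js. if r \<le> x \<and> (x - r, js) \<in> Z then of_bool (w (x - r, js)) else \<sigma> x js)"

definition fair_bits :: "'a set \<Rightarrow> ('a \<Rightarrow> bool) pmf" where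
  "fair_bits Z = Pi_pmf Z False (\<lambda>_. bernoulli_pmf (1/2))"

definition flip_cells :: "nat \<Rightarrow> (nat \<times> nat list) set \<Rightarrow> state \<Rightarrow> state pmf" where
  "flip_cells r Z \<sigma> = map_pmf (\<lambda>w. overlay r Z w \<sigma>) (fair_bits Z)"

lemma flip_cells_empty: "flip_cells r {} \<sigma> = return_pmf \<sigma>"
  by (simp add: flip_cells_def overlay_def fair_bits_def)

lemma fair_bits_Un:
  assumes "finite A" "finite B" "A \<inter> B = {}"
  shows "fair_bits (A \<union> B) =
    fair_bits A \<bind> (\<lambda>v. map_pmf (\<lambda>u z. if z \<in> A then v z else u z) (fair_bits B))"
  using assms
  by (simp add: fair_bits_def Pi_pmf_union pair_pmf_def map_pmf_def bind_assoc_pmf bind_return_pmf)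

lemma flip_cells_Un:
  assumes "finite Z" "finite Z'" "Z \<inter> Z' = {}"
  shows "flip_cells r (Z \<union> Z') \<sigma> = flip_cells r Z \<sigma> \<bind> flip_cells r Z'"
proof -
  have ov: "overlay r (Z \<union> Z') (\<lambda>z. if z \<in> Z then v z else w z) \<sigma> = overlay r Z' w (overlay r Z v \<sigma>)"
    for v w using assms(3) by (auto simp: overlay_def fun_eq_iff)
  have un: "flip_cells r (Z \<union> Z') \<sigma> = fair_bits Z \<bind> (\<lambda>v. map_pmf
      (\<lambda>w. overlay r (Z \<union> Z') (\<lambda>z. if z \<in> Z then v z else w z) \<sigma>) (fair_bits Z'))"
    unfolding flip_cells_def fair_bits_Un[OF assms] map_bind_pmf pmf.map_comp o_def ..
  show ?thesis unfolding un ov by (simp add: flip_cells_def[abs_def] bind_map_pmf)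
qed

lemma flip_cells_upd:
  "x < r \<Longrightarrow> flip_cells r Z (\<sigma>(x := f)) = map_pmf (\<lambda>\<tau>. \<tau>(x := f)) (flip_cells r Z \<sigma>)"
  unfolding flip_cells_def pmf.map_comp
  by (intro map_pmf_cong refl) (auto simp: overlay_def fun_eq_iff)

lemma flip_cells_pres: "\<tau> \<in> set_pmf (flip_cells r Z \<sigma>) \<Longrightarrow> x < r \<Longrightarrow> \<tau> x = \<sigma> x"
  by (auto simp: flip_cells_def overlay_def)

lemma runs_flips:
  "runs (flips s i) \<sigma> (2 * i) (flip_cells (3 + s) ({..<i} \<times> {map (\<lambda>i. \<sigma> (3 + i) []) [0..<s]}) \<sigma>)"
proof (induction i)
  case 0
  then show ?case by (simp add: flip_cells_empty runs_Skip)
next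
  case (Suc i)
  let ?js = "map (\<lambda>i. \<sigma> (3 + i) []) [0..<s]" and ?r = "3 + s"
  have "runs (flips s (Suc i)) \<sigma> (2 * i + 1 + 1)
    (flip_cells ?r ({..<i} \<times> {?js}) \<sigma> \<bind> flip_cells ?r {(i, ?js)})"
    unfolding flips.simps
  proof (rule runs_Seq[OF Suc.IH])
    fix \<tau> assume "\<tau> \<in> set_pmf (flip_cells ?r ({..<i} \<times> {?js}) \<sigma>)"
    then have js: "map (\<lambda>i. \<tau> (3 + i) []) [0..<s] = ?js"
      by (intro vars_cong) (rule flip_cells_pres)
    have "flip_cells ?r {(i, ?js)} \<tau> =
       map_pmf (\<lambda>b. store \<tau> (3 + s + i) (vars s) (of_bool b)) (bernoulli_pmf (1/2))"
      unfolding flip_cells_def fair_bits_def Pi_pmf_singleton pmf.map_comp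
      by (intro map_pmf_cong refl)
         (auto simp: overlay_def store_def eval_vars js fun_eq_iff simp del: map_eq_conv)
    with runs_Flip[of "3 + s + i" "vars s" "Const 1" "Const 2" \<tau>]
    show "runs (Flip (3 + s + i) (vars s) (Const 1) (Const 2)) \<tau> 1 (flip_cells ?r {(i, ?js)} \<tau>)"
      by simp
  qed
  also have "flip_cells ?r ({..<i} \<times> {?js}) \<sigma> \<bind> flip_cells ?r {(i, ?js)} =
      flip_cells ?r ({..<i} \<times> {?js} \<union> {(i, ?js)}) \<sigma>"
    by (rule flip_cells_Un [symmetric]) auto
  also have "{..<i} \<times> {?js} \<union> {(i, ?js)} = {..<Suc i} \<times> {?js}" by auto
  finally show ?case by simp
qed

text \<open>
  The random bit of a hyperedge is read at its sorted index list, which makes the perturbation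
  symmetric; index lists with repetitions, which do not describe hyperedges, are left unperturbed.
\<close>

definition tensor_exp :: "nat \<Rightarrow> nat list \<Rightarrow> exp list \<Rightarrow> exp" where
  "tensor_exp s I es = xor_exp (Read 1 es)
     (and_exp (strict_exp (sort_exp es)) (xor_list_exp (map (\<lambda>i. Read (3 + s + i) (sort_exp es)) I)))"

definition tensor_val :: "nat \<Rightarrow> nat list \<Rightarrow> state \<Rightarrow> nat list \<Rightarrow> nat" where
  "tensor_val s I \<sigma> js = xor_nat (\<sigma> 1 js)
     (of_bool (distinct js) - (1 - foldr xor_nat (map (\<lambda>i. \<sigma> (3 + s + i) (sort js)) I) 0))"

lemma eval_tensor_exp: "eval (tensor_exp s I es) \<sigma> = tensor_val s I \<sigma> (map (\<lambda>e. eval e \<sigma>) es)"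
  by (simp add: tensor_exp_def tensor_val_def eval_and_exp eval_strict_sort_exp eval_xor_list_exp
      eval_sort_exp o_def)

lemma tensor_val_cong:
  "\<sigma> 1 = \<tau> 1 \<Longrightarrow> (\<And>i. i \<in> set I \<Longrightarrow> \<sigma> (3 + s + i) = \<tau> (3 + s + i)) \<Longrightarrow> tensor_val s I \<sigma> js = tensor_val s I \<tau> js"
  unfolding tensor_val_def by (simp cong: map_cong)

text \<open>
  Arrays below \<open>r\<close> belong to the reduction; \<open>copy r M j\<close> places array \<open>x\<close> of the \<open>j\<close>-th of \<open>M\<close>
  disjoint copies of a program above them.
\<close>

definition copy :: "nat \<Rightarrow> nat \<Rightarrow> nat \<Rightarrow> nat \<Rightarrow> nat" where
  "copy r M j x = r + (x * M + j)"

lemma copy_eqD: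
  assumes "j < M" "j' < M" "copy r M j x = copy r M j' x'"
  shows "j = j' \<and> x = x'"
proof -
  have e: "x * M + j = x' * M + j'" using assms(3) by (simp add: copy_def)
  then have "(x * M + j) mod M = (x' * M + j') mod M" "(x * M + j) div M = (x' * M + j') div M" by simp_all
  then show ?thesis using assms by simp
qed

section \<open>Writing the inputs of the copies\<close>

primrec fills :: "nat \<Rightarrow> nat \<Rightarrow> nat list list \<Rightarrow> nat \<Rightarrow> com" where
  "fills s d Ls 0 = Skip"
| "fills s d Ls (Suc j) = Seq (fills s d Ls j)
     (Assign (copy (3 + s + d) (length Ls) j 1) (vars s) (tensor_exp s (Ls ! j) (vars s)))"

text \<open>Since \<open>copy\<close> interleaves the copies, array 1 of copy \<open>j\<close> is
  \<open>a + j\<close>: the adjacency tensors of all copies form one contiguous block.\<close>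

definition fill_cells :: "nat \<Rightarrow> nat \<Rightarrow> nat list list \<Rightarrow> nat \<Rightarrow> nat list set \<Rightarrow> state \<Rightarrow> state" where
  "fill_cells s d Ls m C \<sigma> = (\<lambda>x js.
     let a = 3 + s + d + length Ls in
     if js \<in> C \<and> a \<le> x \<and> x < a + m then tensor_val s (Ls ! (x - a)) \<sigma> js else \<sigma> x js)"

text \<open>The written values depend on the input tensor and the directions only, and these lie in
  arrays below the block being written. So earlier writes do not disturb later ones.\<close>

lemma fill_cells_Un:
  assumes "set ` set Ls \<subseteq> Pow {..<d}" "m \<le> length Ls" "C \<inter> C' = {}"
  shows "fill_cells s d Ls m (C \<union> C') \<sigma> = fill_cells s d Ls m C' (fill_cells s d Ls m C \<sigma>)"
proof -
  let ?a = "3 + s + d + length Ls"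
  have "tensor_val s (Ls ! (x - ?a)) (fill_cells s d Ls m C \<sigma>) js = tensor_val s (Ls ! (x - ?a)) \<sigma> js"
    if "?a \<le> x" "x < ?a + m" for x js
  proof (rule tensor_val_cong)
    fix i assume "i \<in> set (Ls ! (x - ?a))"
    moreover have "Ls ! (x - ?a) \<in> set Ls" using that assms(2) by auto
    ultimately have "i < d" using assms(1) by auto
    then show "fill_cells s d Ls m C \<sigma> (3 + s + i) = \<sigma> (3 + s + i)"
      by (simp add: fill_cells_def)
  qed (simp add: fill_cells_def)
  then show ?thesis using assms(3)
    by (auto simp: fun_eq_iff fill_cells_def[of _ _ _ _ C'] fill_cells_def[of _ _ _ _ "C \<union> C'"] Let_def)
       (auto simp: fill_cells_def Let_def)
qed

lemma fill_cells_upd: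
  assumes "i < s"
  shows "fill_cells s d Ls m C (\<sigma>(3 + i := f)) = (fill_cells s d Ls m C \<sigma>)(3 + i := f)"
proof -
  have "tensor_val s I (\<sigma>(3 + i := f)) js = tensor_val s I \<sigma> js" for I js
    using assms by (intro tensor_val_cong) auto
  then show ?thesis using assms by (auto simp: fun_eq_iff fill_cells_def Let_def)
qed

lemma fill_cells_pres: "x < 3 + s + d \<Longrightarrow> fill_cells s d Ls m C \<sigma> x = \<sigma> x"
  by (simp add: fill_cells_def)

lemma runs_fills:
  assumes Ls: "set ` set Ls \<subseteq> Pow {..<d}"
  shows "m \<le> length Ls \<Longrightarrow> runs (fills s d Ls m) \<sigma> (2 * m)
    (return_pmf (fill_cells s d Ls m {map (\<lambda>i. \<sigma> (3 + i) []) [0..<s]} \<sigma>))"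
proof (induction m)
  case 0
  have "fill_cells s d Ls 0 C \<sigma> = \<sigma>" for C by (auto simp: fill_cells_def Let_def fun_eq_iff)
  then show ?case by (simp add: runs_Skip)
next
  case (Suc m)
  let ?js = "map (\<lambda>i. \<sigma> (3 + i) []) [0..<s]"
  let ?\<tau> = "fill_cells s d Ls m {?js} \<sigma>"
  let ?c = "Assign (copy (3 + s + d) (length Ls) m 1) (vars s) (tensor_exp s (Ls ! m) (vars s))"
  have js: "map (\<lambda>i. ?\<tau> (3 + i) []) [0..<s] = ?js"
    by (intro vars_cong) (simp add: fill_cells_pres)
  have "Ls ! m \<in> set Ls" using Suc.prems by simp
  then have I: "i < d" if "i \<in> set (Ls ! m)" for i using that Ls by auto
  have "tensor_val s (Ls ! m) ?\<tau> ?js = tensor_val s (Ls ! m) \<sigma> ?js"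
    using I by (intro tensor_val_cong) (auto simp: fill_cells_pres)
  then have "store ?\<tau> (copy (3 + s + d) (length Ls) m 1) (vars s) (eval (tensor_exp s (Ls ! m) (vars s)) ?\<tau>) =
    fill_cells s d Ls (Suc m) {?js} \<sigma>"
    unfolding store_def eval_tensor_exp eval_vars js
    by (auto simp: fun_eq_iff fill_cells_def copy_def Let_def less_Suc_eq simp del: map_eq_conv)
  then have "runs ?c ?\<tau> 1 (return_pmf (fill_cells s d Ls (Suc m) {?js} \<sigma>))"
    using runs_Assign by metis
  then have "runs (fills s d Ls (Suc m)) \<sigma> (2 * m + 1 + 1)
     (return_pmf ?\<tau> \<bind> (\<lambda>_. return_pmf (fill_cells s d Ls (Suc m) {?js} \<sigma>)))"
    unfolding fills.simps using Suc by (intro runs_Seq) auto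
  then show ?case by (simp add: bind_return_pmf)
qed

text \<open>\<open>r + j\<close> is array 0 of copy \<open>j\<close>, where that copy expects the
  number of vertices.\<close>

primrec sizes :: "nat \<Rightarrow> nat \<Rightarrow> com" where
  "sizes r 0 = Skip"
| "sizes r (Suc j) = Seq (sizes r j) (Assign (r + j) [] (Read 0 []))"

definition set_sizes :: "nat \<Rightarrow> nat \<Rightarrow> state \<Rightarrow> state" where
  "set_sizes r m \<sigma> = (\<lambda>x js. if js = [] \<and> r \<le> x \<and> x < r + m then \<sigma> 0 [] else \<sigma> x js)"

lemma runs_sizes: "0 < r \<Longrightarrow> runs (sizes r m) \<sigma> (2 * m) (return_pmf (set_sizes r m \<sigma>))"
proof (induction m)
  case 0
  have "set_sizes r 0 \<sigma> = \<sigma>" by (simp add: set_sizes_def fun_eq_iff)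
  then show ?case by (simp add: runs_Skip)
next
  case (Suc m)
  have "store (set_sizes r m \<sigma>) (r + m) [] (eval (Read 0 []) (set_sizes r m \<sigma>)) = set_sizes r (Suc m) \<sigma>"
    using Suc.prems by (auto simp: store_def set_sizes_def fun_eq_iff less_Suc_eq)
  then have "runs (Assign (r + m) [] (Read 0 [])) (set_sizes r m \<sigma>) 1 (return_pmf (set_sizes r (Suc m) \<sigma>))"
    using runs_Assign by metis
  then have "runs (sizes r (Suc m)) \<sigma> (2 * m + 1 + 1)
     (return_pmf (set_sizes r m \<sigma>) \<bind> (\<lambda>_. return_pmf (set_sizes r (Suc m) \<sigma>)))"
    unfolding sizes.simps using Suc by (intro runs_Seq) auto
  then show ?case by (simp add: bind_return_pmf)
qed

definition sampler :: "nat \<Rightarrow> nat \<Rightarrow> nat list list \<Rightarrow> com" where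
  "sampler s d Ls = Seq (nest s (flips s d))
     (Seq (nest s (fills s d Ls (length Ls))) (sizes (3 + s + d) (length Ls)))"

definition sampler_time :: "nat \<Rightarrow> nat \<Rightarrow> nat \<Rightarrow> nat \<Rightarrow> nat" where
  "sampler_time s d M n = nest_time (2 * d) n s + 1 + (nest_time (2 * M) n s + 1 + 2 * M)"

definition words :: "nat \<Rightarrow> nat \<Rightarrow> nat list set" where
  "words s n = {js. length js = s \<and> set js \<subseteq> {..<n}}"

lemma tuples_words: "tuples s n s v = words s n"
  by (auto simp: tuples_def words_def in_set_conv_nth subset_iff)

definition prepared :: "nat \<Rightarrow> nat \<Rightarrow> nat list list \<Rightarrow> nat \<Rightarrow> state \<Rightarrow> (nat \<times> nat list \<Rightarrow> bool) \<Rightarrow> state" where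
  "prepared s d Ls n \<sigma> w = set_sizes (3 + s + d) (length Ls)
     (fill_cells s d Ls (length Ls) (words s n) (overlay (3 + s) ({..<d} \<times> words s n) w \<sigma>))"

lemma runs_sampler:
  assumes Ls: "set ` set Ls \<subseteq> Pow {..<d}" and v: "\<forall>i<s. \<sigma> (3 + i) [] = 0" and n: "\<sigma> 0 [] = n"
  shows "runs (sampler s d Ls) \<sigma> (sampler_time s d (length Ls) n)
    (map_pmf (prepared s d Ls n \<sigma>) (fair_bits ({..<d} \<times> words s n)))"
proof -
  let ?M = "length Ls"
  let ?K = "\<lambda>C. flip_cells (3 + s) ({..<d} \<times> C)"
  have "runs (nest s (flips s d)) \<sigma> (nest_time (2 * d) n s) (?K (tuples s n s (\<lambda>i. \<sigma> (3 + i) [])) \<sigma>)"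
  proof (rule runs_nest)
    fix C C' :: "nat list set" and \<sigma>
    assume "finite C" "finite C'" "C \<inter> C' = {}"
    then show "?K (C \<union> C') \<sigma> = ?K C \<sigma> \<bind> ?K C'"
      unfolding Sigma_Un_distrib2 by (intro flip_cells_Un) auto
  next
    fix C \<sigma> i f assume "i < s"
    then show "?K C (\<sigma>(3 + i := f)) = map_pmf (\<lambda>\<tau>. \<tau>(3 + i := f)) (?K C \<sigma>)"
      by (intro flip_cells_upd) simp
  qed (use v n in \<open>auto simp: flip_cells_empty intro: flip_cells_pres runs_flips\<close>)
  then have 1: "runs (nest s (flips s d)) \<sigma> (nest_time (2 * d) n s) (?K (words s n) \<sigma>)"
    by (simp only: tuples_words)
  have 2: "runs (nest s (fills s d Ls ?M)) \<tau> (nest_time (2 * ?M) n s)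
      (return_pmf (fill_cells s d Ls ?M (words s n) \<tau>))"
    if "\<tau> \<in> set_pmf (?K (words s n) \<sigma>)" for \<tau>
  proof -
    have pres: "\<tau> x = \<sigma> x" if "x < 3 + s" for x
      using that flip_cells_pres \<open>\<tau> \<in> _\<close> by blast
    have "runs (nest s (fills s d Ls ?M)) \<tau> (nest_time (2 * ?M) n s)
      (return_pmf (fill_cells s d Ls ?M (tuples s n s (\<lambda>i. \<tau> (3 + i) [])) \<tau>))"
    proof (rule runs_nest[where K = "\<lambda>C \<sigma>. return_pmf (fill_cells s d Ls ?M C \<sigma>)"])
      show "runs (fills s d Ls ?M) \<sigma> (2 * ?M)
        (return_pmf (fill_cells s d Ls ?M {map (\<lambda>i. \<sigma> (3 + i) []) [0..<s]} \<sigma>))" for \<sigma>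
        using Ls by (rule runs_fills) simp
    qed (use v n pres Ls in \<open>auto simp: fill_cells_Un bind_return_pmf fill_cells_upd fill_cells_pres
        simp del: fun_upd_apply\<close>, simp add: fill_cells_def)
    then show ?thesis by (simp only: tuples_words)
  qed
  have "runs (Seq (nest s (fills s d Ls ?M)) (sizes (3 + s + d) ?M)) \<tau>
      (nest_time (2 * ?M) n s + 1 + 2 * ?M)
      (return_pmf (fill_cells s d Ls ?M (words s n) \<tau>) \<bind>
        (\<lambda>\<tau>. return_pmf (set_sizes (3 + s + d) ?M \<tau>)))"
    if "\<tau> \<in> set_pmf (?K (words s n) \<sigma>)" for \<tau>
    using that by (intro runs_Seq 2 runs_sizes) simp_all
  with 1 have "runs (sampler s d Ls) \<sigma> (sampler_time s d ?M n)
     (?K (words s n) \<sigma> \<bind> (\<lambda>\<tau>. return_pmf (fill_cells s d Ls ?M (words s n) \<tau>) \<bind>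
        (\<lambda>\<tau>. return_pmf (set_sizes (3 + s + d) ?M \<tau>))))"
    unfolding sampler_def sampler_time_def by (rule runs_Seq)
  then show ?thesis
    by (simp add: flip_cells_def bind_map_pmf bind_return_pmf prepared_def[abs_def] map_pmf_def bind_assoc_pmf)
qed

text \<open>The sum, over the field with two elements, of the directions listed in
  \<open>I\<close>.\<close>

definition perturbation :: "nat \<Rightarrow> nat \<Rightarrow> nat list \<Rightarrow> (nat \<times> nat list \<Rightarrow> bool) \<Rightarrow> nat set set" where
  "perturbation s n I w = {e \<in> nsets {..<n} s. odd (length (filter (\<lambda>i. w (i, sorted_list_of_set e)) I))}"

lemma prepared_copy:
  assumes Ls: "set ` set Ls \<subseteq> Pow {..<d}" and j: "j < length Ls" and E: "E \<in> hypergraphs s n"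
  shows "prepared s d Ls n (input s n E) w \<circ> copy (3 + s + d) (length Ls) j =
    input s n (sym_diff E (perturbation s n (Ls ! j) w))"
proof (intro ext)
  fix x js
  let ?M = "length Ls" and ?r = "3 + s + d" and ?I = "Ls ! j"
  let ?G = "sym_diff E (perturbation s n (Ls ! j) w)"
  let ?o = "overlay (3 + s) ({..<d} \<times> words s n) w (input s n E)"
  have i: "i < d" if "i \<in> set ?I" for i
    using that Ls j nth_mem[of j Ls] by blast
  have G: "?G \<subseteq> nsets {..<n} s" using E by (auto simp: hypergraphs_def perturbation_def)
  show "(prepared s d Ls n (input s n E) w \<circ> copy ?r ?M j) x js = input s n ?G x js"
  proof -
    consider "x = 0" | "x = 1" | "x \<ge> 2" by linarith
    then show ?thesis
    proof cases
      case 1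
      then show ?thesis using j
        by (auto simp: prepared_def copy_def set_sizes_def fill_cells_def overlay_def input_def Let_def)
    next
      case 2
      have pj: "(prepared s d Ls n (input s n E) w \<circ> copy ?r ?M j) x js =
        (if js \<in> words s n then tensor_val s ?I ?o js else 0)"
        using j 2 by (auto simp: prepared_def copy_def set_sizes_def fill_cells_def overlay_def input_def Let_def)
      show ?thesis
      proof (cases "js \<in> words s n \<and> distinct js")
        \<comment> \<open>Such a list describes no hyperedge, so the cell has to be 0. Cells outside
          \<open>words\<close> are never written, and for lists with repetitions the distinctness
          factor masks the random bits.\<close>
        case False
        have "set js \<notin> nsets {..<n} s" if "length js = s"
          using False that card_distinct[of js] by (auto simp: words_def nsets_def)
        then have "of_bool (length js = s \<and> set js \<in> ?G) = (0::nat)"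
          "of_bool (length js = s \<and> set js \<in> E) = (0::nat)"
          using G E unfolding hypergraphs_def by auto
        then show ?thesis unfolding pj using False 2
          by (auto simp: input_def tensor_val_def overlay_def xor_nat_def)
      next
        case True
        have srt: "sort js = sorted_list_of_set (set js)"
          using True by (simp add: sorted_list_of_set_sort_remdups distinct_remdups_id)
        have "sort js \<in> words s n" using True by (auto simp: words_def)
        then have m: "map (\<lambda>i. ?o (3 + s + i) (sort js)) ?I = map (\<lambda>i. of_bool (w (i, sort js))) ?I"
          using i by (auto simp: overlay_def)
        have "?o 1 js = of_bool (set js \<in> E)"
          using True by (auto simp: overlay_def input_def words_def)
        then have "tensor_val s ?I ?o js = of_bool ((set js \<in> E) \<noteq> odd (length (filter (\<lambda>i. w (i, sort js)) ?I)))"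
          using True unfolding tensor_val_def m foldr_xor_nat by (auto simp: xor_nat_def)
        moreover have "set js \<in> nsets {..<n} s" using True by (auto simp: words_def nsets_def distinct_card)
        ultimately show ?thesis unfolding pj using True 2
          by (auto simp: input_def perturbation_def srt words_def)
      qed
    next
      case 3
      \<comment> \<open>Arrays 2 and above of every copy lie beyond the two blocks of sizes and
        tensors.\<close>
      then have "2 * ?M \<le> x * ?M" by (rule mult_le_mono1)
      then have "?r + 2 * ?M \<le> copy ?r ?M j x" unfolding copy_def by linarith
      moreover have "prepared s d Ls n (input s n E) w y js = 0" if "?r + 2 * ?M \<le> y" for y
        using that j
        by (auto simp: prepared_def set_sizes_def fill_cells_def overlay_def input_def Let_def)
      ultimately show ?thesis using 3 by (simp add: input_def)
    qed
  qed
qed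

section \<open>The clique polynomial\<close>

lemma even_card_involution:
  assumes "finite X" "\<And>x. x \<in> X \<Longrightarrow> f x \<in> X" "\<And>x. x \<in> X \<Longrightarrow> f (f x) = x" "\<And>x. x \<in> X \<Longrightarrow> f x \<noteq> x"
  shows "even (card X)"
  using assms
proof (induction "card X" arbitrary: X rule: less_induct)
  case less
  show ?case
  proof (cases "X = {}")
    case False
    then obtain x where x: "x \<in> X" by blast
    let ?Y = "X - {x, f x}"
    have sub: "{x, f x} \<subseteq> X" "card {x, f x} = 2" using x less.prems(2,4)[OF x] by auto
    have "card X = card ?Y + 2"
      using sub less.prems(1) card_Diff_subset[of "{x, f x}" X] card_mono[OF less.prems(1) sub(1)] by simp
    moreover have "f y \<in> ?Y" if "y \<in> ?Y" for y
      using that x less.prems(2,3) by (metis Diff_iff insert_iff empty_iff)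
    then have "even (card ?Y)"
      using \<open>card X = _\<close> less.prems by (intro less.hyps) auto
    ultimately show ?thesis by simp
  qed simp
qed

lemma odd_card_sym_diff:
  assumes "finite A" "finite B"
  shows "odd (card (sym_diff A B)) \<longleftrightarrow> odd (card A) \<noteq> odd (card B)"
proof -
  have "card A = card (A - B) + card (A \<inter> B)" "card B = card (B - A) + card (A \<inter> B)"
    using card_Int_Diff[OF assms(1), of B] card_Int_Diff[OF assms(2), of A] by (simp_all add: Int_commute)
  moreover have "card (sym_diff A B) = card (A - B) + card (B - A)"
    using assms by (intro card_Un_disjoint) auto
  ultimately show ?thesis by auto
qed

lemma sum_card_swap:
  assumes "finite A" "finite B"
  shows "(\<Sum>a\<in>A. card {b\<in>B. R a b}) = (\<Sum>b\<in>B. card {a\<in>A. R a b})"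
proof -
  have "(\<Sum>a\<in>A. card {b\<in>B. R a b}) = (\<Sum>a\<in>A. \<Sum>b\<in>B. of_bool (R a b))"
    using assms by (simp add: Int_def)
  also have "\<dots> = (\<Sum>b\<in>B. \<Sum>a\<in>A. of_bool (R a b))" by (rule sum.swap)
  also have "\<dots> = (\<Sum>b\<in>B. card {a\<in>A. R a b})" using assms by (simp add: Int_def)
  finally show ?thesis .
qed

lemma cliques_nsets: "cliques k s n E = {C \<in> nsets {..<n} k. nsets C s \<subseteq> E}"
  by (auto simp: cliques_def nsets_def finite_subset)

lemma finite_nsets: "finite A \<Longrightarrow> finite (nsets A s)"
  by (rule finite_imp_finite_nsets)

text \<open>Differentiating more often than the degree of the clique polynomial annihilates it.\<close>

lemma even_sum_cliques:
  fixes P :: "nat \<Rightarrow> nat set \<Rightarrow> bool"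
  assumes E: "E \<in> hypergraphs s n" and d: "k choose s < d"
  shows "even (\<Sum>S\<in>Pow {..<d}. card (cliques k s n
    (sym_diff E {e \<in> nsets {..<n} s. odd (card {i\<in>S. P i e})})))"
proof -
  let ?Y = "\<lambda>S. {e \<in> nsets {..<n} s. odd (card {i\<in>S. P i e})}"
  let ?K = "nsets {..<n} k"
  have "even (card {S \<in> Pow {..<d}. nsets C s \<subseteq> sym_diff E (?Y S)})" if C: "C \<in> ?K" for C
  proof -
    have sub: "nsets C s \<subseteq> nsets {..<n} s" using C by (intro nsets_mono) (auto simp: nsets_def)
    have fin: "finite (nsets C s)" using C by (intro finite_nsets) (auto simp: nsets_def)
    let ?\<phi> = "\<lambda>S. {e \<in> nsets C s. odd (card {i\<in>S. P i e})}"
    \<comment> \<open>Pigeonhole in place of a degree argument: there are more index sets than edge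
      sets inside \<open>C\<close>, so two index sets have direction sums that coincide inside
      \<open>C\<close>. Adding their symmetric difference \<open>T\<close> does not change whether
      \<open>C\<close> is a clique, and this pairs off the index sets.\<close>
    have "card (Pow (nsets C s)) < card (Pow {..<d})"
      using C d fin by (simp add: card_Pow card_nsets) (simp add: nsets_def)
    then have "\<not> inj_on ?\<phi> (Pow {..<d})"
      using card_inj_on_le[of ?\<phi> "Pow {..<d}" "Pow (nsets C s)"] fin by fastforce
    then obtain S1 S2 where S: "S1 \<subseteq> {..<d}" "S2 \<subseteq> {..<d}" "?\<phi> S1 = ?\<phi> S2" "S1 \<noteq> S2"
      unfolding inj_on_def by blast
    define T where "T = sym_diff S1 S2"
    have sd: "odd (card {i\<in>sym_diff S S'. P i e}) \<longleftrightarrow> odd (card {i\<in>S. P i e}) \<noteq> odd (card {i\<in>S'. P i e})"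
      if "S \<subseteq> {..<d}" "S' \<subseteq> {..<d}" for S S' e
    proof -
      have "{i\<in>sym_diff S S'. P i e} = sym_diff {i\<in>S. P i e} {i\<in>S'. P i e}" by auto
      moreover have "finite S" "finite S'" using that finite_subset by blast+
      ultimately show ?thesis
        using odd_card_sym_diff[of "{i\<in>S. P i e}" "{i\<in>S'. P i e}"] by simp
    qed
    have T: "T \<subseteq> {..<d}" "T \<noteq> {}" using S by (auto simp: T_def)
    have evT: "even (card {i\<in>T. P i e})" if "e \<in> nsets C s" for e
    proof -
      have "e \<in> ?\<phi> S1 \<longleftrightarrow> e \<in> ?\<phi> S2" by (simp only: S(3))
      then show ?thesis using that sd[OF S(1,2), of e] unfolding T_def by simp
    qed
    have eq: "nsets C s \<subseteq> sym_diff E (?Y (sym_diff S T)) \<longleftrightarrow> nsets C s \<subseteq> sym_diff E (?Y S)"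
      if S': "S \<subseteq> {..<d}" for S
    proof -
      have "e \<in> ?Y (sym_diff S T) \<longleftrightarrow> e \<in> ?Y S" if "e \<in> nsets C s" for e
        using evT[OF that] sd[OF S' T(1), of e] by simp
      then have mem: "e \<in> sym_diff E (?Y (sym_diff S T)) \<longleftrightarrow> e \<in> sym_diff E (?Y S)" if "e \<in> nsets C s" for e
        using that by (simp only: Un_iff Diff_iff)
      show ?thesis unfolding subset_iff by (intro all_cong1 imp_cong refl mem)
    qed
    show ?thesis
    proof (rule even_card_involution[where f = "\<lambda>S. sym_diff S T"])
      fix S assume S: "S \<in> {S \<in> Pow {..<d}. nsets C s \<subseteq> sym_diff E (?Y S)}"
      then have "S \<subseteq> {..<d}" "nsets C s \<subseteq> sym_diff E (?Y S)" by simp_all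
      moreover from this have "sym_diff S T \<subseteq> {..<d}" using T(1) by blast
      ultimately show "sym_diff S T \<in> {S \<in> Pow {..<d}. nsets C s \<subseteq> sym_diff E (?Y S)}"
        using eq[of S] by simp
      show "sym_diff (sym_diff S T) T = S" by blast
      show "sym_diff S T \<noteq> S" using T(2) by blast
    qed simp
  qed
  moreover have "(\<Sum>S\<in>Pow {..<d}. card (cliques k s n (sym_diff E (?Y S)))) =
     (\<Sum>C\<in>?K. card {S \<in> Pow {..<d}. nsets C s \<subseteq> sym_diff E (?Y S)})"
    unfolding cliques_nsets by (rule sum_card_swap) (simp_all add: finite_nsets)
  ultimately show ?thesis by (simp add: dvd_sum)
qed

text \<open>Summed over all ways \<open>Z\<close> of switching edges inside \<open>C\<close>, the
  clique count is odd. Exactly one \<open>Z\<close> completes \<open>C\<close> itself, whereas any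
  other \<open>k\<close>-set misses a vertex of \<open>C\<close> and hence some edge of
  \<open>C\<close>, and toggling that edge does not affect it. A constant parity over the even
  number of choices would make the sum even.\<close>

lemma clique_parity_attains:
  assumes C: "C \<in> nsets {..<n} k" and s: "1 \<le> s" "s \<le> k" and b: "b < 2"
  shows "\<exists>Z\<in>Pow (nsets C s). parity_clique k s n (sym_diff E Z) = b"
proof (rule ccontr)
  assume neg: "\<not> ?thesis"
  let ?X = "Pow (nsets C s)" and ?K = "nsets {..<n} k"
  let ?c = "\<lambda>Z. card (cliques k s n (sym_diff E Z))"
  have C': "finite C" "card C = k" using C by (auto simp: nsets_def)
  have fin: "finite ?X" using C' by (simp add: finite_nsets)
  have "card (nsets C s) \<noteq> 0" using C' s by (simp add: card_nsets)
  then have ev: "even (card ?X)" using C' by (simp add: card_Pow finite_nsets)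
  have other: "even (card {Z\<in>?X. nsets C' s \<subseteq> sym_diff E Z})" if C'K: "C' \<in> ?K - {C}" for C'
  proof -
    have "finite C'" "card C' = k" using C'K by (auto simp: nsets_def)
    then have "\<not> C \<subseteq> C'" using C'K C' card_subset_eq[of C' C] by auto
    then obtain v where v: "v \<in> C" "v \<notin> C'" by blast
    have "s - 1 \<le> card (C - {v})" using C' s v by simp
    then obtain e' where e': "e' \<subseteq> C - {v}" "card e' = s - 1" "finite e'"
      using obtain_subset_with_card_n by metis
    define e where "e = insert v e'"
    have "v \<notin> e'" using e' by auto
    then have e: "e \<in> nsets C s" "e \<notin> nsets C' s"
      using e' v s by (auto simp: e_def nsets_def)
    then have mem: "e' \<in> sym_diff E (sym_diff Z {e}) \<longleftrightarrow> e' \<in> sym_diff E Z" if "e' \<in> nsets C' s" for Z e'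
      using that by auto
    have eq: "nsets C' s \<subseteq> sym_diff E (sym_diff Z {e}) \<longleftrightarrow> nsets C' s \<subseteq> sym_diff E Z" for Z
      unfolding subset_iff by (intro all_cong1 imp_cong refl mem)
    show ?thesis
    proof (rule even_card_involution[where f = "\<lambda>Z. sym_diff Z {e}"])
      fix Z assume "Z \<in> {Z\<in>?X. nsets C' s \<subseteq> sym_diff E Z}"
      then have "Z \<subseteq> nsets C s" "nsets C' s \<subseteq> sym_diff E Z" by simp_all
      moreover from this have "sym_diff Z {e} \<subseteq> nsets C s" using e by blast
      ultimately show "sym_diff Z {e} \<in> {Z\<in>?X. nsets C' s \<subseteq> sym_diff E Z}"
        using eq[of Z] by simp
      show "sym_diff (sym_diff Z {e}) {e} = Z" by blast
      show "sym_diff Z {e} \<noteq> Z" by blast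
    qed (use fin in simp)
  qed
  have "{Z\<in>?X. nsets C s \<subseteq> sym_diff E Z} = {nsets C s - E}" by auto
  then have self: "card {Z\<in>?X. nsets C s \<subseteq> sym_diff E Z} = 1" by simp
  have "(\<Sum>Z\<in>?X. ?c Z) = (\<Sum>C'\<in>?K. card {Z\<in>?X. nsets C' s \<subseteq> sym_diff E Z})"
    unfolding cliques_nsets using fin by (intro sum_card_swap) (simp_all add: finite_nsets)
  also have "\<dots> = 1 + (\<Sum>C'\<in>?K - {C}. card {Z\<in>?X. nsets C' s \<subseteq> sym_diff E Z})"
    using self by (subst sum.remove[OF _ C]) (simp_all add: finite_nsets)
  moreover have "even (\<Sum>C'\<in>?K - {C}. card {Z\<in>?X. nsets C' s \<subseteq> sym_diff E Z})"
    using other by (intro dvd_sum)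
  ultimately have "odd (\<Sum>Z\<in>?X. ?c Z)" by simp
  moreover have "?c Z mod 2 = 1 - b" if "Z \<in> ?X" for Z
  proof -
    have "?c Z mod 2 \<noteq> b" using neg that by (auto simp: parity_clique_def)
    moreover have "?c Z mod 2 < 2" by simp
    ultimately show ?thesis using b by linarith
  qed
  then have "{Z\<in>?X. odd (?c Z)} = (if b = 0 then ?X else {})"
    using b by (auto simp: odd_iff_mod_2_eq_one)
  ultimately show False using ev fin by (simp add: even_sum_iff split: if_splits)
qed

section \<open>A query lower bound\<close>

fun reads :: "exp \<Rightarrow> state \<Rightarrow> nat list set" where
  "reads (Const m) \<sigma> = {}"
| "reads (Read x js) \<sigma> = (if x = 1 then {map (\<lambda>e. eval e \<sigma>) js} else {}) \<union> (\<Union>e\<in>set js. reads e \<sigma>)"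
| "reads (Add a b) \<sigma> = reads a \<sigma> \<union> reads b \<sigma>"
| "reads (Monus a b) \<sigma> = reads a \<sigma> \<union> reads b \<sigma>"

fun read_count :: "exp \<Rightarrow> nat" where
  "read_count (Const m) = 0"
| "read_count (Read x js) = 1 + sum_list (map read_count js)"
| "read_count (Add a b) = read_count a + read_count b"
| "read_count (Monus a b) = read_count a + read_count b"

lemma card_UN_list_le:
  "(\<And>e. e \<in> set es \<Longrightarrow> finite (f e) \<and> card (f e) \<le> g e) \<Longrightarrow>
    finite (\<Union>e\<in>set es. f e) \<and> card (\<Union>e\<in>set es. f e) \<le> sum_list (map g es)"
proof (induction es)
  case (Cons e es)
  then have "card (f e) \<le> g e" "card (\<Union>e\<in>set es. f e) \<le> sum_list (map g es)"
    "finite (f e)" "finite (\<Union>e\<in>set es. f e)" by auto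
  moreover have "card (f e \<union> (\<Union>e\<in>set es. f e)) \<le> card (f e) + card (\<Union>e\<in>set es. f e)"
    by (rule card_Un_le)
  ultimately show ?case by simp
qed simp

lemma card_reads: "finite (reads e \<sigma>) \<and> card (reads e \<sigma>) \<le> read_count e"
proof (induction e \<sigma> rule: reads.induct)
  case (2 x js \<sigma>)
  let ?U = "\<Union>e\<in>set js. reads e \<sigma>"
  have U: "finite ?U \<and> card ?U \<le> sum_list (map read_count js)"
    using 2 by (intro card_UN_list_le) auto
  have "card ((if x = 1 then {map (\<lambda>e. eval e \<sigma>) js} else {}) \<union> ?U) \<le> 1 + card ?U"
    by (rule order_trans[OF card_Un_le]) simp
  then show ?case using U by auto
next
  case (3 a b \<sigma>)
  then show ?case using card_Un_le[of "reads a \<sigma>" "reads b \<sigma>"] by auto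
next
  case (4 a b \<sigma>)
  then show ?case using card_Un_le[of "reads a \<sigma>" "reads b \<sigma>"] by auto
qed simp

primrec com_reads :: "com \<Rightarrow> state \<Rightarrow> nat list set" where
  "com_reads Skip \<sigma> = {}"
| "com_reads (Assign x js e) \<sigma> = (\<Union>e'\<in>set (e # js). reads e' \<sigma>)"
| "com_reads (Flip x js a b) \<sigma> = (\<Union>e'\<in>set (a # b # js). reads e' \<sigma>)"
| "com_reads (Seq c d) \<sigma> = com_reads c \<sigma>"
| "com_reads (Cond e c d) \<sigma> = reads e \<sigma>"
| "com_reads (While e c) \<sigma> = reads e \<sigma>"

text \<open>A maximum over all statements of the program, so that it never grows during a run and
  bounds the reads of every single step.\<close>

primrec read_bound :: "com \<Rightarrow> nat" where
  "read_bound Skip = 0"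
| "read_bound (Assign x js e) = sum_list (map read_count (e # js))"
| "read_bound (Flip x js a b) = sum_list (map read_count (a # b # js))"
| "read_bound (Seq c d) = max (read_bound c) (read_bound d)"
| "read_bound (Cond e c d) = max (read_count e) (max (read_bound c) (read_bound d))"
| "read_bound (While e c) = max (read_count e) (read_bound c)"

lemma card_com_reads: "finite (com_reads c \<sigma>) \<and> card (com_reads c \<sigma>) \<le> read_bound c"
proof (induction c)
  case (Assign x js e)
  show ?case unfolding com_reads.simps read_bound.simps by (rule card_UN_list_le) (rule card_reads)
next
  case (Flip x js a b)
  show ?case unfolding com_reads.simps read_bound.simps by (rule card_UN_list_le) (rule card_reads)
next
  case (Cond e c d)
  then show ?case using card_reads[of e \<sigma>] by auto
next
  case (While e c)
  then show ?case using card_reads[of e \<sigma>] by auto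
qed auto

lemma read_bound_step: "cfg \<in> set_pmf (step c \<sigma>) \<Longrightarrow> read_bound (fst cfg) \<le> read_bound c"
proof (induction c arbitrary: cfg)
  case (Seq c d)
  then show ?case by (fastforce split: if_splits)
qed (auto split: if_splits)

definition agree :: "nat list set \<Rightarrow> state \<Rightarrow> state \<Rightarrow> bool" where
  "agree V \<sigma> \<tau> \<longleftrightarrow> (\<forall>x js. x \<noteq> 1 \<or> js \<notin> V \<longrightarrow> \<sigma> x js = \<tau> x js)"

lemma eval_agree: "agree V \<sigma> \<tau> \<Longrightarrow> reads e \<sigma> \<inter> V = {} \<Longrightarrow> eval e \<tau> = eval e \<sigma>"
proof (induction e \<sigma> rule: eval.induct)
  case (2 x js \<sigma>)
  then have "map (\<lambda>e. eval e \<tau>) js = map (\<lambda>e. eval e \<sigma>) js" by auto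
  moreover have "\<sigma> x (map (\<lambda>e. eval e \<sigma>) js) = \<tau> x (map (\<lambda>e. eval e \<sigma>) js)"
    using 2 unfolding agree_def by (auto split: if_splits)
  ultimately show ?case by (simp only: eval.simps)
qed (auto simp: Int_Un_distrib2)

lemma agree_store:
  assumes "agree V \<sigma> \<tau>" "\<forall>e\<in>set js. reads e \<sigma> \<inter> V = {}"
  shows "agree V (store \<sigma> x js m) (store \<tau> x js m)"
proof -
  have "map (\<lambda>e. eval e \<tau>) js = map (\<lambda>e. eval e \<sigma>) js"
    using assms eval_agree by auto
  then show ?thesis using assms(1) by (auto simp: agree_def store_def simp del: map_eq_conv)
qed

text \<open>Coupling by common coins: while no cell in \<open>V\<close> is read, biases, addresses
  and guards have the same values in both states.\<close>

lemma rel_step_agree: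
  "agree V \<sigma> \<tau> \<Longrightarrow> com_reads c \<sigma> \<inter> V = {} \<Longrightarrow>
    rel_pmf (rel_prod (=) (agree V)) (step c \<sigma>) (step c \<tau>)"
proof (induction c)
  case (Assign x js e)
  then have "eval e \<tau> = eval e \<sigma>" by (intro eval_agree) auto
  moreover have "agree V (store \<sigma> x js m) (store \<tau> x js m)" for m
    using Assign by (intro agree_store) auto
  ultimately show ?case by simp
next
  case (Flip x js a b)
  then have "eval a \<tau> = eval a \<sigma>" "eval b \<tau> = eval b \<sigma>" by (auto intro!: eval_agree)
  moreover have "agree V (store \<sigma> x js m) (store \<tau> x js m)" for m
    using Flip by (intro agree_store) auto
  ultimately show ?case by (simp add: pmf.rel_map) (rule pmf.rel_refl, simp)
next
  case (Seq c d)
  show ?case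
  proof (cases "c = Skip")
    case False
    have "rel_pmf (rel_prod (=) (agree V)) (step c \<sigma>) (step c \<tau>)" using Seq by simp
    then have "rel_pmf (\<lambda>x y. rel_prod (=) (agree V) (Seq (fst x) d, snd x) (Seq (fst y) d, snd y))
        (step c \<sigma>) (step c \<tau>)"
      by (rule pmf.rel_mono_strong) auto
    then show ?thesis using False by (simp add: pmf.rel_map case_prod_unfold)
  qed (use Seq in simp)
next
  case (Cond e c d)
  then show ?case using eval_agree[of V \<sigma> \<tau> e] by auto
next
  case (While e c)
  then show ?case using eval_agree[of V \<sigma> \<tau> e] by auto
qed simp

text \<open>The probability that one of the first \<open>t\<close> steps reads a cell of array 1
  with index in \<open>V\<close>; the recursion stops at the first such read.\<close>

primrec touch :: "nat list set \<Rightarrow> nat \<Rightarrow> com \<times> state \<Rightarrow> real" where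
  "touch V 0 cfg = 0"
| "touch V (Suc t) cfg = (if com_reads (fst cfg) (snd cfg) \<inter> V = {}
     then measure_pmf.expectation (step (fst cfg) (snd cfg)) (touch V t) else 1)"

lemma touch_nonneg: "0 \<le> touch V t cfg"
  by (induction t arbitrary: cfg) (auto intro: Bochner_Integration.integral_nonneg)

lemma expectation_rel_le:
  fixes f :: "'a \<Rightarrow> real" and g :: "'b \<Rightarrow> real"
  assumes "rel_pmf R p q" "finite (set_pmf p)" "finite (set_pmf q)" "\<And>x y. R x y \<Longrightarrow> f x \<le> g y + h x"
  shows "measure_pmf.expectation p f \<le> measure_pmf.expectation q g + measure_pmf.expectation p h"
proof -
  obtain pq where pq: "\<And>x y. (x, y) \<in> set_pmf pq \<Longrightarrow> R x y" "map_pmf fst pq = p" "map_pmf snd pq = q"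
    using assms(1) by (auto elim: rel_pmf.cases)
  have "set_pmf pq \<subseteq> set_pmf p \<times> set_pmf q" by (force simp flip: pq(2,3))
  then have fin: "finite (set_pmf pq)" using assms(2,3) by (meson finite_SigmaI finite_subset)
  have "measure_pmf.expectation p f = measure_pmf.expectation pq (\<lambda>x. f (fst x))"
    by (simp flip: pq(2))
  also have "\<dots> \<le> measure_pmf.expectation pq (\<lambda>x. g (snd x) + h (fst x))"
    using fin pq(1) assms(4)
    by (intro integral_mono_AE integrable_measure_pmf_finite) (auto simp: AE_measure_pmf_iff)
  also have "\<dots> = measure_pmf.expectation pq (\<lambda>x. g (snd x)) + measure_pmf.expectation pq (\<lambda>x. h (fst x))"
    using fin by (intro Bochner_Integration.integral_add integrable_measure_pmf_finite)
  also have "\<dots> = measure_pmf.expectation q g + measure_pmf.expectation p h"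
    by (simp flip: pq(2,3))
  finally show ?thesis .
qed

lemma prob_steps_Suc:
  "measure_pmf.prob (steps (Suc t) (c, \<sigma>)) A =
   measure_pmf.expectation (step c \<sigma>) (\<lambda>cfg. measure_pmf.prob (steps t cfg) A)"
  using expectation_steps_Suc[of t c \<sigma> "indicator A"] by simp

text \<open>Both runs share their coins until a cell in \<open>V\<close> is read. Up to then the
  states differ in array 1 only, while the result stands in array 2.\<close>

lemma prob_outputs_agree:
  "agree V \<sigma> \<tau> \<Longrightarrow> measure_pmf.prob (steps t (c, \<sigma>)) {cfg. outputs cfg b} \<le>
    measure_pmf.prob (steps t (c, \<tau>)) {cfg. outputs cfg b} + touch V t (c, \<sigma>)"
proof (induction t arbitrary: c \<sigma> \<tau>)
  case 0
  then have "outputs (c, \<sigma>) b \<longleftrightarrow> outputs (c, \<tau>) b" by (simp add: outputs_def halted_def agree_def)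
  then show ?case by (simp add: measure_return indicator_def)
next
  case (Suc t)
  show ?case
  proof (cases "com_reads c \<sigma> \<inter> V = {}")
    case True
    have "measure_pmf.expectation (step c \<sigma>) (\<lambda>cfg. measure_pmf.prob (steps t cfg) {cfg. outputs cfg b}) \<le>
      measure_pmf.expectation (step c \<tau>) (\<lambda>cfg. measure_pmf.prob (steps t cfg) {cfg. outputs cfg b}) +
      measure_pmf.expectation (step c \<sigma>) (touch V t)"
      using rel_step_agree[OF Suc.prems True]
      by (rule expectation_rel_le) (auto simp: finite_set_step Suc.IH)
    then show ?thesis using True by (simp add: prob_steps_Suc del: steps.simps)
  next
    case False
    have "measure_pmf.prob (steps (Suc t) (c, \<sigma>)) {cfg. outputs cfg b} \<le> 1" by simp
    also have "1 \<le> measure_pmf.prob (steps (Suc t) (c, \<tau>)) {cfg. outputs cfg b} + touch V (Suc t) (c, \<sigma>)"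
      using False by (simp del: steps.simps)
    finally show ?thesis .
  qed
qed

text \<open>Double counting: a step reads at most \<open>q\<close> cells and each belongs to at most
  \<open>m\<close> of the sets \<open>W C\<close>, so every step adds at most \<open>q * m\<close>
  to the sum.\<close>

lemma sum_touch_le:
  fixes W :: "'a \<Rightarrow> nat list set"
  assumes fin: "finite K" and m: "\<And>js. card {C\<in>K. js \<in> W C} \<le> m"
  shows "read_bound (fst cfg) \<le> q \<Longrightarrow> (\<Sum>C\<in>K. touch (W C) t cfg) \<le> real (t * (q * m))"
proof (induction t arbitrary: cfg)
  case (Suc t)
  obtain c \<sigma> where cfg: "cfg = (c, \<sigma>)" by (cases cfg)
  let ?R = "com_reads c \<sigma>"
  let ?E = "measure_pmf.expectation (step c \<sigma>)"
  have "card {C\<in>K. ?R \<inter> W C \<noteq> {}} \<le> card (\<Union>js\<in>?R. {C\<in>K. js \<in> W C})"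
  proof (rule card_mono)
    show "finite (\<Union>js\<in>?R. {C\<in>K. js \<in> W C})" using card_com_reads[of c \<sigma>] fin by simp
    show "{C\<in>K. ?R \<inter> W C \<noteq> {}} \<subseteq> (\<Union>js\<in>?R. {C\<in>K. js \<in> W C})" by blast
  qed
  also have "\<dots> \<le> (\<Sum>js\<in>?R. card {C\<in>K. js \<in> W C})"
    using card_com_reads[of c \<sigma>] by (intro card_UN_le) blast
  also have "\<dots> \<le> card ?R * m" using sum_bounded_above[OF m] by simp
  also have "\<dots> \<le> q * m" using card_com_reads[of c \<sigma>] Suc.prems cfg by (intro mult_right_mono) auto
  finally have R: "card {C\<in>K. ?R \<inter> W C \<noteq> {}} \<le> q * m" .
  have nn: "0 \<le> ?E (touch (W C) t)" for C
    by (intro Bochner_Integration.integral_nonneg touch_nonneg)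
  have "(\<Sum>C\<in>K. touch (W C) (Suc t) cfg) \<le> (\<Sum>C\<in>K. of_bool (?R \<inter> W C \<noteq> {}) + ?E (touch (W C) t))"
    using nn by (intro sum_mono) (auto simp: cfg)
  also have "\<dots> = real (card {C\<in>K. ?R \<inter> W C \<noteq> {}}) + (\<Sum>C\<in>K. ?E (touch (W C) t))"
    using fin by (simp add: sum.distrib Int_def)
  also have "(\<Sum>C\<in>K. ?E (touch (W C) t)) = ?E (\<lambda>cfg. \<Sum>C\<in>K. touch (W C) t cfg)"
    by (intro Bochner_Integration.integral_sum [symmetric] integrable_measure_pmf_finite finite_set_step)
  also have "\<dots> \<le> ?E (\<lambda>cfg. real (t * (q * m)))"
  proof (intro integral_mono_AE integrable_measure_pmf_finite finite_set_step)
    show "AE cfg in step c \<sigma>. (\<Sum>C\<in>K. touch (W C) t cfg) \<le> real (t * (q * m))"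
      unfolding AE_measure_pmf_iff
    proof
      fix cfg' assume "cfg' \<in> set_pmf (step c \<sigma>)"
      then have "read_bound (fst cfg') \<le> q"
        using read_bound_step[of cfg' c \<sigma>] Suc.prems cfg by simp
      then show "(\<Sum>C\<in>K. touch (W C) t cfg') \<le> real (t * (q * m))" by (rule Suc.IH)
    qed
  qed
  also have "real (card {C\<in>K. ?R \<inter> W C \<noteq> {}}) + ?E (\<lambda>cfg. real (t * (q * m))) \<le> real (q * m) + real (t * (q * m))"
    using of_nat_mono[OF R, where 'a = real] by simp
  finally show ?case by (simp add: algebra_simps)
qed simp

section \<open>Averaging over uniformly random hypergraphs\<close>

lemma hypergraphs_Pow: "hypergraphs s n = Pow (nsets {..<n} s)"
  by (auto simp: hypergraphs_def)

lemma finite_hypergraphs: "finite (hypergraphs s n)"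
  by (simp add: hypergraphs_Pow finite_nsets)

lemma random_hypergraph_uniform: "random_hypergraph n (1/2) s = pmf_of_set (hypergraphs s n)"
  unfolding random_hypergraph_def hypergraphs_Pow
  by (rule pmf_of_set_Pow_conv_bernoulli) (simp add: finite_nsets)

lemma expectation_random_hypergraph:
  "measure_pmf.expectation (random_hypergraph n (1/2) s) f =
    (\<Sum>E\<in>hypergraphs s n. f E) / real (card (hypergraphs s n))"
  unfolding random_hypergraph_uniform
  by (rule integral_pmf_of_set) (auto simp: hypergraphs_Pow finite_nsets)

text \<open>A \<open>k\<close>-set that contains a given hyperedge is determined by its other
  \<open>k - s\<close> vertices.\<close>

lemma card_nsets_containing:
  assumes "s \<le> k"
  shows "card {C \<in> nsets {..<n} k. length js = s \<and> set js \<in> nsets C s} \<le> n ^ (k - s)"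
proof -
  let ?X = "{C \<in> nsets {..<n} k. length js = s \<and> set js \<in> nsets C s}"
  have "card ?X \<le> card (nsets {..<n} (k - s))"
  proof (rule card_inj_on_le)
    show "inj_on (\<lambda>C. C - set js) ?X"
    proof (rule inj_onI)
      fix C C' assume "C \<in> ?X" "C' \<in> ?X" "C - set js = C' - set js"
      then have "set js \<subseteq> C" "set js \<subseteq> C'" by (auto simp: nsets_def)
      with \<open>C - set js = C' - set js\<close> show "C = C'" by blast
    qed
    show "(\<lambda>C. C - set js) ` ?X \<subseteq> nsets {..<n} (k - s)"
      by (auto simp: nsets_def card_Diff_subset)
  qed (simp add: finite_nsets)
  also have "\<dots> \<le> n ^ (k - s)"
  proof (cases "k - s \<le> n")
    case True
    then show ?thesis by (simp add: card_nsets binomial_le_pow)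
  next
    case False
    then show ?thesis by (simp add: card_nsets binomial_eq_0)
  qed
  finally show ?thesis .
qed

lemma sym_diff_cancel: "sym_diff (sym_diff E Z) Z = E"
  by blast

lemma sum_sym_diff_shift:
  assumes "Z \<subseteq> U"
  shows "(\<Sum>E\<in>Pow U. f (sym_diff E Z)) = (\<Sum>E\<in>Pow U. f E)"
proof (rule sum.reindex_bij_witness[where i = "\<lambda>E. sym_diff E Z" and j = "\<lambda>E. sym_diff E Z"])
  show "sym_diff E Z \<in> Pow U" if "E \<in> Pow U" for E using that assms by blast
  then show "sym_diff E Z \<in> Pow U" if "E \<in> Pow U" for E using that by blast
qed (simp_all only: sym_diff_cancel)

lemma outputs_prob_add_le:
  assumes "b \<noteq> b'"
  shows "measure_pmf.prob p {cfg. outputs cfg b} + measure_pmf.prob p {cfg. outputs cfg b'} \<le> 1"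
proof -
  have "measure_pmf.prob p {cfg. outputs cfg b} + measure_pmf.prob p {cfg. outputs cfg b'} =
    measure_pmf.prob p ({cfg. outputs cfg b} \<union> {cfg. outputs cfg b'})"
    using assms by (intro measure_pmf.finite_measure_Union [symmetric]) (auto simp: outputs_def)
  then show ?thesis by simp
qed

text \<open>
  A run that inspects no edge inside the vertex set \<open>C\<close> behaves identically on all hypergraphs
  that differ only inside \<open>C\<close>, among which both clique parities occur.
\<close>

lemma errors_on_cube:
  assumes C: "C \<in> nsets {..<n} k" and s: "1 \<le> s" "s \<le> k"
    and halts: "\<And>E. E \<in> hypergraphs s n \<Longrightarrow> halts_within T A (input s n E)"
    and E: "E \<in> hypergraphs s n"
  shows "1 \<le> (\<Sum>Z\<in>Pow (nsets C s). error_prob k s A n (sym_diff E Z) +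
    touch {js. length js = s \<and> set js \<in> nsets C s} T (A, input s n (sym_diff E Z)))"
proof -
  let ?V = "{js. length js = s \<and> set js \<in> nsets C s}"
  let ?G = "\<lambda>Z. sym_diff E Z"
  let ?P = "\<lambda>Z b. measure_pmf.prob (steps T (A, input s n (?G Z))) {cfg. outputs cfg b}"
  let ?t = "\<lambda>Z. touch ?V T (A, input s n (?G Z))"
  let ?e = "\<lambda>Z. error_prob k s A n (?G Z)"
  have sub: "nsets C s \<subseteq> nsets {..<n} s" using C by (intro nsets_mono) (auto simp: nsets_def)
  have fin: "finite (nsets C s)" using C by (intro finite_nsets) (auto simp: nsets_def)
  have G: "?G Z \<in> hypergraphs s n" if "Z \<in> Pow (nsets C s)" for Z
  proof -
    have "Z \<subseteq> nsets {..<n} s" "E \<subseteq> nsets {..<n} s" using that sub E by (auto simp: hypergraphs_def)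
    then show ?thesis unfolding hypergraphs_def by blast
  qed
  have e: "?e Z = 1 - ?P Z (parity_clique k s n (?G Z))" if "Z \<in> Pow (nsets C s)" for Z
    unfolding error_prob_def using output_prob_eq[OF halts[OF G[OF that]]] by simp
  have nn: "0 \<le> ?e Z + ?t Z" if "Z \<in> Pow (nsets C s)" for Z
    using touch_nonneg[of ?V T "(A, input s n (?G Z))"] unfolding e[OF that] by (simp add: add_nonneg_nonneg)
  obtain Z0 where Z0: "Z0 \<in> Pow (nsets C s)" "parity_clique k s n (?G Z0) = 0"
    using clique_parity_attains[OF C s, of 0 E] by (auto simp only: simp_thms zero_less_numeral)
  obtain Z1 where Z1: "Z1 \<in> Pow (nsets C s)" "parity_clique k s n (?G Z1) = 1"
    using clique_parity_attains[OF C s, of 1 E] by (auto simp only: simp_thms one_less_numeral_iff semiring_norm)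
  have "agree ?V (input s n (?G Z0)) (input s n (?G Z1))"
  proof -
    have mem: "e \<in> ?G Z0 \<longleftrightarrow> e \<in> ?G Z1" if "e \<notin> nsets C s" for e
      using that Z0(1) Z1(1) by (simp only: Un_iff Diff_iff Pow_iff) blast
    show ?thesis
      unfolding agree_def
    proof (intro allI impI)
      fix x :: nat and js assume js: "x \<noteq> 1 \<or> js \<notin> ?V"
      show "input s n (?G Z0) x js = input s n (?G Z1) x js"
      proof (cases "x = 1 \<and> length js = s")
        case True
        then have "set js \<notin> nsets C s" using js by simp
        from mem[OF this] show ?thesis unfolding input_def by (simp only:)
      next
        case False
        then show ?thesis by (cases "x = 1") (simp_all add: input_def)
      qed
    qed
  qed
  \<comment> \<open>The answer 0, correct at \<open>Z0\<close>, persists up to the touching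
    probability at \<open>Z1\<close>, where it is wrong. So the two errors and this probability add
    up to at least 1.\<close>
  then have "?P Z0 0 \<le> ?P Z1 0 + ?t Z0" by (rule prob_outputs_agree)
  moreover have "?P Z1 0 + ?P Z1 1 \<le> 1" by (rule outputs_prob_add_le) simp
  ultimately have "1 \<le> (?e Z0 + ?t Z0) + (?e Z1 + ?t Z1)"
    using e[OF Z0(1)] e[OF Z1(1)] Z0(2) Z1(2)
      touch_nonneg[of ?V T "(A, input s n (?G Z1))"] by simp
  also have "\<dots> = (\<Sum>Z\<in>{Z0, Z1}. ?e Z + ?t Z)"
  proof -
    have "Z0 \<noteq> Z1" using Z0(2) Z1(2) by force
    then show ?thesis by simp
  qed
  also have "\<dots> \<le> (\<Sum>Z\<in>Pow (nsets C s). ?e Z + ?t Z)"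
  proof (rule sum_mono2)
    show "{Z0, Z1} \<subseteq> Pow (nsets C s)" using Z0(1) Z1(1) by blast
    show "0 \<le> ?e Z + ?t Z" if "Z \<in> Pow (nsets C s) - {Z0, Z1}" for Z using that by (intro nn) blast
  qed (use fin in simp)
  finally show ?thesis .
qed

text \<open>Switching a fixed set of edges permutes the hypergraphs, so averaging
  \<open>errors_on_cube\<close> gives, for each \<open>C\<close>, that mean error plus mean touching
  probability is at least \<open>1 / 2 ^ (k choose s)\<close>. The error accounts for at most half
  of this. Summed over all \<open>C\<close>, touching is bounded by
  \<open>T * read_bound A * n ^ (k - s)\<close>, while the number of sets \<open>C\<close> is at
  least \<open>(n / k) ^ k\<close>; cancelling \<open>n ^ (k - s)\<close> leaves
  \<open>n ^ s\<close>.\<close>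

lemma query_lower_bound:
  assumes s: "1 \<le> s" "s \<le> k" and n: "k \<le> n"
    and halts: "\<And>E. E \<in> hypergraphs s n \<Longrightarrow> halts_within T A (input s n E)"
    and err: "measure_pmf.expectation (random_hypergraph n (1/2) s) (error_prob k s A n) \<le>
      1 / 2 ^ ((k choose s) + 1)"
  shows "real n ^ s \<le> 2 ^ ((k choose s) + 1) * real k ^ k * real (read_bound A) * real T"
proof -
  let ?U = "nsets {..<n} s" and ?K = "nsets {..<n} k" and ?H = "hypergraphs s n"
  let ?D = "2 ^ (k choose s) :: real"
  let ?q = "read_bound A" and ?m = "n ^ (k - s)"
  let ?V = "\<lambda>C. {js. length js = s \<and> set js \<in> nsets C s}"
  let ?t = "\<lambda>C E. touch (?V C) T (A, input s n E)"
  let ?e = "error_prob k s A n"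
  let ?N = "real (card ?H)"
  have N: "0 < ?N" using finite_hypergraphs[of s n] by (auto simp: hypergraphs_Pow card_gt_0_iff)
  have one: "?N \<le> ?D * ((\<Sum>E\<in>?H. ?e E) + (\<Sum>E\<in>?H. ?t C E))" if C: "C \<in> ?K" for C
  proof -
    have sub: "nsets C s \<subseteq> ?U" using C by (intro nsets_mono) (auto simp: nsets_def)
    have "finite C" "card C = k" using C by (auto simp: nsets_def)
    then have "card (nsets C s) = k choose s" "finite (nsets C s)"
      by (simp_all add: card_nsets finite_nsets)
    then have card: "real (card (Pow (nsets C s))) = ?D" by (simp add: card_Pow)
    have "?N = (\<Sum>E\<in>?H. 1)" by simp
    also have "\<dots> \<le> (\<Sum>E\<in>?H. \<Sum>Z\<in>Pow (nsets C s). ?e (sym_diff E Z) + ?t C (sym_diff E Z))"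
      by (intro sum_mono errors_on_cube C s halts)
    also have "\<dots> = (\<Sum>Z\<in>Pow (nsets C s). \<Sum>E\<in>?H. ?e (sym_diff E Z) + ?t C (sym_diff E Z))"
      by (rule sum.swap)
    also have "\<dots> = (\<Sum>Z\<in>Pow (nsets C s). \<Sum>E\<in>?H. ?e E + ?t C E)"
      unfolding hypergraphs_Pow using sub
      by (intro sum.cong refl sum_sym_diff_shift[where f = "\<lambda>E. ?e E + ?t C E"]) auto
    also have "\<dots> = ?D * (\<Sum>E\<in>?H. ?e E + ?t C E)" by (simp add: card)
    finally show ?thesis by (simp add: sum.distrib)
  qed
  have "real (card ?K) * ?N = (\<Sum>C\<in>?K. ?N)" by simp
  also have "\<dots> \<le> (\<Sum>C\<in>?K. ?D * ((\<Sum>E\<in>?H. ?e E) + (\<Sum>E\<in>?H. ?t C E)))" by (intro sum_mono one)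
  also have "\<dots> = ?D * (real (card ?K) * (\<Sum>E\<in>?H. ?e E) + (\<Sum>C\<in>?K. \<Sum>E\<in>?H. ?t C E))"
    by (simp add: sum_distrib_left[symmetric] sum.distrib)
  finally have sums: "real (card ?K) * ?N \<le>
    ?D * (real (card ?K) * (\<Sum>E\<in>?H. ?e E) + (\<Sum>C\<in>?K. \<Sum>E\<in>?H. ?t C E))" .
  have "(\<Sum>C\<in>?K. \<Sum>E\<in>?H. ?t C E) = (\<Sum>E\<in>?H. \<Sum>C\<in>?K. ?t C E)" by (rule sum.swap)
  also have "\<dots> \<le> (\<Sum>E\<in>?H. real (T * (?q * ?m)))"
  proof (rule sum_mono)
    fix E
    show "(\<Sum>C\<in>?K. ?t C E) \<le> real (T * (?q * ?m))"
    proof (rule sum_touch_le)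
      show "card {C \<in> ?K. js \<in> ?V C} \<le> ?m" for js
        using card_nsets_containing[OF s(2)] by simp
    qed (simp_all add: finite_nsets)
  qed
  also have "\<dots> = ?N * real (T * (?q * ?m))" by simp
  finally have touches: "(\<Sum>C\<in>?K. \<Sum>E\<in>?H. ?t C E) \<le> ?N * real (T * (?q * ?m))" .
  have "(\<Sum>E\<in>?H. ?e E) \<le> ?N / (2 * ?D)"
    using err N unfolding expectation_random_hypergraph by (simp add: field_simps)
  then have "?D * (real (card ?K) * (\<Sum>E\<in>?H. ?e E) + (\<Sum>C\<in>?K. \<Sum>E\<in>?H. ?t C E)) \<le>
      ?D * (real (card ?K) * (?N / (2 * ?D)) + ?N * real (T * (?q * ?m)))"
    using touches by (intro mult_left_mono add_mono) simp_all
  with sums have "real (card ?K) * ?N \<le> ?D * (real (card ?K) * (?N / (2 * ?D)) + ?N * real (T * (?q * ?m)))"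
    by (rule order_trans)
  also have "\<dots> = ?N * (real (card ?K) / 2 + ?D * real (T * (?q * ?m)))"
    by (simp add: field_simps)
  finally have "?N * real (card ?K) \<le> ?N * (real (card ?K) / 2 + ?D * real (T * (?q * ?m)))"
    by (simp only: mult.commute)
  then have K: "real (card ?K) \<le> 2 * ?D * real (T * (?q * ?m))"
    using N by (simp add: mult_le_cancel_left_pos)
  have k: "0 < k" using s by simp
  have "real n ^ s * real n ^ (k - s) = real n ^ k" using s by (simp flip: power_add)
  also have "\<dots> = real k ^ k * (real n / real k) ^ k" using k by (simp add: power_divide)
  also have "\<dots> \<le> real k ^ k * real (card ?K)"
    using binomial_ge_n_over_k_pow_k[OF n, where 'a = real] by (simp add: card_nsets mult_left_mono)
  also have "\<dots> \<le> real k ^ k * (2 * ?D * real (T * (?q * ?m)))"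
    using K by (intro mult_left_mono) auto
  also have "\<dots> = (2 ^ ((k choose s) + 1) * real k ^ k * real ?q * real T) * real n ^ (k - s)"
    by simp
  finally show ?thesis using n k by (simp add: mult_le_cancel_right)
qed

section \<open>The reduction\<close>

lemma odd_filter_split:
  assumes "distinct I" "i0 \<in> set I"
  shows "odd (length (filter P I)) \<longleftrightarrow> P i0 \<noteq> odd (length (filter (\<lambda>i. i \<noteq> i0 \<and> P i) I))"
proof -
  obtain I1 I2 where I: "I = I1 @ i0 # I2" using assms(2) by (meson split_list)
  then have "i0 \<notin> set I1" "i0 \<notin> set I2" using assms(1) by auto
  then have "filter (\<lambda>i. i \<noteq> i0 \<and> P i) I1 = filter P I1" "filter (\<lambda>i. i \<noteq> i0 \<and> P i) I2 = filter P I2"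
    by (auto intro!: filter_cong)
  then show ?thesis by (auto simp: I)
qed

lemma finite_words: "finite (words s n)"
  using finite_lists_length_eq[of "{..<n}" s] by (simp add: words_def conj_commute)

lemma sorted_list_nsets:
  assumes "e \<in> nsets {..<n} s"
  shows "sorted_list_of_set e \<in> words s n" "set (sorted_list_of_set e) = e"
  using assms by (auto simp: nsets_def words_def)

text \<open>The map \<open>h\<close> matches edges with cells, so the bits describe a uniform subset
  of \<open>U\<close>; adding a fixed \<open>B\<close> is an involution of the subsets and preserves
  uniformity.\<close>

lemma translate_uniform:
  assumes "finite U" "B \<subseteq> U" "inj_on h U"
  shows "map_pmf (\<lambda>u. sym_diff B {e \<in> U. u (h e)}) (fair_bits (h ` U)) = pmf_of_set (Pow U)"
proof -
  have 1: "map_pmf (\<lambda>u. {x \<in> h ` U. u x}) (fair_bits (h ` U)) = pmf_of_set (Pow (h ` U))"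
    unfolding fair_bits_def using assms(1) by (intro pmf_of_set_Pow_conv_bernoulli) simp
  have bij1: "bij_betw (\<lambda>W. {e \<in> U. h e \<in> W}) (Pow (h ` U)) (Pow U)"
  proof (rule bij_betw_byWitness[where f' = "image h"])
    show "\<forall>W\<in>Pow (h ` U). h ` {e \<in> U. h e \<in> W} = W" by auto
    show "\<forall>F\<in>Pow U. {e \<in> U. h e \<in> h ` F} = F"
      using assms(3) by (auto simp: inj_on_def)
  qed auto
  have inv: "sym_diff B (sym_diff B F) = F" for F by blast
  have sub: "sym_diff B F \<subseteq> U" if "F \<subseteq> U" for F using that assms(2) by blast
  have bij2: "bij_betw (sym_diff B) (Pow U) (Pow U)"
    by (rule bij_betw_byWitness[where f' = "sym_diff B"])
       (simp_all only: inv image_subset_iff Pow_iff Ball_def simp_thms, (intro allI impI sub; assumption)+)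
  have "map_pmf (sym_diff B) (map_pmf (\<lambda>W. {e \<in> U. h e \<in> W}) (pmf_of_set (Pow (h ` U)))) = pmf_of_set (Pow U)"
    using assms(1) map_pmf_of_set_bij_betw[OF bij1] map_pmf_of_set_bij_betw[OF bij2]
    by (simp add: Pow_not_empty)
  then show ?thesis
    unfolding 1 [symmetric] pmf.map_comp o_def by (simp cong: conj_cong)
qed

text \<open>
  Conditioning on all directions but one in \<open>I\<close> leaves a translate of a uniformly random hypergraph.
\<close>

lemma perturbed_uniform:
  assumes I: "distinct I" "I \<noteq> []" "set I \<subseteq> {..<d}" and E: "E \<in> hypergraphs s n"
  shows "map_pmf (\<lambda>w. sym_diff E (perturbation s n I w)) (fair_bits ({..<d} \<times> words s n)) =
    random_hypergraph n (1/2) s"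
proof -
  let ?U = "nsets {..<n} s" and ?sl = "sorted_list_of_set :: nat set \<Rightarrow> nat list"
  obtain i0 where i0: "i0 \<in> set I" using I(2) by (cases I) auto
  \<comment> \<open>\<open>Z0\<close> consists of the cells that encode direction \<open>i0\<close>
    on the hyperedges; all other bits, indexed by \<open>Z1\<close>, are conditioned on.\<close>
  define Z0 where "Z0 = (\<lambda>e. (i0, ?sl e)) ` ?U"
  define Z1 where "Z1 = {..<d} \<times> words s n - Z0"
  have Z0: "Z0 \<subseteq> {..<d} \<times> words s n" using i0 I(3) sorted_list_nsets(1) by (auto simp: Z0_def)
  have fin: "finite Z0" "finite Z1" by (simp_all add: Z0_def Z1_def finite_nsets finite_words)
  have Un: "{..<d} \<times> words s n = Z1 \<union> Z0" "Z1 \<inter> Z0 = {}" using Z0 by (auto simp: Z1_def)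
  \<comment> \<open>The part fixed by the conditioning: \<open>E\<close> plus the sum of the
    directions in \<open>I\<close> other than \<open>i0\<close>.\<close>
  define B where "B v = sym_diff E {e \<in> ?U. odd (length (filter (\<lambda>i. i \<noteq> i0 \<and> v (i, ?sl e)) I))}"
    for v :: "nat \<times> nat list \<Rightarrow> bool"
  have EU: "E \<subseteq> ?U" using E by (simp add: hypergraphs_def)
  then have B: "B v \<subseteq> ?U" for v unfolding B_def by blast
  have split: "sym_diff E (perturbation s n I (\<lambda>z. if z \<in> Z1 then v z else u z)) =
      sym_diff (B v) {e \<in> ?U. u (i0, ?sl e)}" for u v
  proof -
    have "e \<in> perturbation s n I (\<lambda>z. if z \<in> Z1 then v z else u z) \<longleftrightarrow>
       u (i0, ?sl e) \<noteq> odd (length (filter (\<lambda>i. i \<noteq> i0 \<and> v (i, ?sl e)) I))" if "e \<in> ?U" for e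
    proof -
      have rest: "filter (\<lambda>i. i \<noteq> i0 \<and> (if (i, ?sl e) \<in> Z1 then v (i, ?sl e) else u (i, ?sl e))) I =
        filter (\<lambda>i. i \<noteq> i0 \<and> v (i, ?sl e)) I"
        using that I(3) sorted_list_nsets(1)[OF that]
        by (intro filter_cong) (auto simp: Z0_def Z1_def)
      have "(i0, ?sl e) \<notin> Z1" using that by (auto simp: Z0_def Z1_def)
      then show ?thesis
        using that odd_filter_split[OF I(1) i0,
            of "\<lambda>i. if (i, ?sl e) \<in> Z1 then v (i, ?sl e) else u (i, ?sl e)"]
        unfolding rest by (simp add: perturbation_def)
    qed
    then have mem: "e \<in> perturbation s n I (\<lambda>z. if z \<in> Z1 then v z else u z) \<longleftrightarrow>
       u (i0, ?sl e) \<noteq> odd (length (filter (\<lambda>i. i \<noteq> i0 \<and> v (i, ?sl e)) I))" if "e \<in> ?U" for e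
      using that .
    show ?thesis
    proof (rule set_eqI)
      fix e
      show "e \<in> sym_diff E (perturbation s n I (\<lambda>z. if z \<in> Z1 then v z else u z)) \<longleftrightarrow>
        e \<in> sym_diff (B v) {e \<in> ?U. u (i0, ?sl e)}"
      proof (cases "e \<in> ?U")
        case True
        then have "(i0, ?sl e) \<in> Z0" by (auto simp: Z0_def)
        then show ?thesis
          using True unfolding B_def Un_iff Diff_iff mem[OF True] mem_Collect_eq
          by (cases "e \<in> E"; cases "u (i0, ?sl e)") (simp_all only: simp_thms)
      next
        case False
        then have "e \<notin> E" "e \<notin> perturbation s n I (\<lambda>z. if z \<in> Z1 then v z else u z)" "e \<notin> B v"
          using EU B[of v] by (blast, simp add: perturbation_def, blast)
        with False show ?thesis by (simp only: Un_iff Diff_iff mem_Collect_eq simp_thms)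
      qed
    qed
  qed
  have inj: "inj_on (\<lambda>e. (i0, ?sl e)) ?U"
  proof (rule inj_onI)
    fix e e' assume e: "e \<in> ?U" "e' \<in> ?U" "(i0, ?sl e) = (i0, ?sl e')"
    have "e = set (?sl e)" using e(1) by (rule sorted_list_nsets(2) [symmetric])
    also have "\<dots> = set (?sl e')" using e(3) by (simp only: prod.inject)
    also have "\<dots> = e'" using e(2) by (rule sorted_list_nsets(2))
    finally show "e = e'" .
  qed
  have unif: "map_pmf (\<lambda>u. sym_diff (B v) {e \<in> ?U. u (i0, ?sl e)}) (fair_bits Z0) =
      pmf_of_set (Pow ?U)" for v
    unfolding Z0_def by (rule translate_uniform[OF finite_nsets[OF finite_lessThan] B inj])
  have "map_pmf (\<lambda>w. sym_diff E (perturbation s n I w)) (fair_bits ({..<d} \<times> words s n)) =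
    fair_bits Z1 \<bind> (\<lambda>v. map_pmf (\<lambda>u. sym_diff E (perturbation s n I (\<lambda>z. if z \<in> Z1 then v z else u z)))
      (fair_bits Z0))"
    unfolding Un(1) fair_bits_Un[OF fin(2,1) Un(2)] map_bind_pmf pmf.map_comp o_def ..
  also have "\<dots> = pmf_of_set (Pow ?U)" unfolding split unif by (rule bind_pmf_const)
  finally show ?thesis by (simp add: random_hypergraph_uniform hypergraphs_Pow)
qed

lemma prob_bind_finite:
  assumes "finite (set_pmf p)" "\<And>x. x \<in> set_pmf p \<Longrightarrow> finite (set_pmf (f x))"
  shows "measure_pmf.prob (p \<bind> f) S = measure_pmf.expectation p (\<lambda>x. measure_pmf.prob (f x) S)"
  using expectation_bind_finite[OF assms, where h = "indicator S"] by simp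

section \<open>Running disjoint copies and combining their answers\<close>

primrec copies :: "nat \<Rightarrow> nat \<Rightarrow> com \<Rightarrow> nat \<Rightarrow> com" where
  "copies r M A 0 = Skip"
| "copies r M A (Suc j) = Seq (copies r M A j) (rename (copy r M j) A)"

lemma inj_copy: "j < M \<Longrightarrow> inj (copy r M j)"
  using copy_eqD by (blast intro: injI)

lemma embed_copy_other:
  assumes "j < M" "j' < M" "j \<noteq> j'"
  shows "embed (copy r M j) \<sigma> \<tau> (copy r M j' x) = \<sigma> (copy r M j' x)"
proof -
  have "copy r M j' x \<notin> range (copy r M j)" using copy_eqD assms by blast
  then show ?thesis by (simp add: embed_def)
qed

lemma embed_copy_same: "j < M \<Longrightarrow> embed (copy r M j) \<sigma> \<tau> (copy r M j x) = \<tau> x"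
  using embed_comp[OF inj_copy] by (metis comp_apply)

lemma steps_rename_self:
  "inj f \<Longrightarrow> steps t (rename f c, \<sigma>) =
     map_pmf (\<lambda>(c', \<tau>'). (rename f c', embed f \<sigma> \<tau>')) (steps t (c, \<sigma> \<circ> f))"
  using steps_rename[of f t c \<sigma> "\<sigma> \<circ> f"] by (simp add: embed_self)

text \<open>Copy \<open>m\<close> writes only its own arrays: the later copies still find their
  inputs, which keeps the induction going, and the earlier answers survive. So each copy adds just
  its own error to the probability that some answer is wrong.\<close>

lemma copies_spec:
  assumes "m \<le> M" "\<forall>j<m. halts_within T A (\<sigma> \<circ> copy r M j)"
  shows "halts_within (m * (T + 1)) (copies r M A m) \<sigma>"
    and "\<forall>cfg\<in>set_pmf (steps (m * (T + 1)) (copies r M A m, \<sigma>)).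
           \<forall>j<M. m \<le> j \<longrightarrow> snd cfg \<circ> copy r M j = \<sigma> \<circ> copy r M j"
    and "measure_pmf.prob (steps (m * (T + 1)) (copies r M A m, \<sigma>))
           {cfg. \<exists>j<m. snd cfg (copy r M j 2) [] \<noteq> b j}
         \<le> (\<Sum>j<m. 1 - output_prob A (\<sigma> \<circ> copy r M j) (b j))"
  using assms
proof (induction m)
  case 0
  {
    case 1
    then show ?case by simp
  next
    case 2
    then show ?case by simp
  next
    case 3
    then show ?case by simp
  }
next
  case (Suc m)
  have prems: "m \<le> M" "\<forall>j<m. halts_within T A (\<sigma> \<circ> copy r M j)" "m < M"
    if "Suc m \<le> M" "\<forall>j<Suc m. halts_within T A (\<sigma> \<circ> copy r M j)"
    using that by auto
  let ?c = "copies r M A m" and ?f = "copy r M m" and ?t = "m * (T + 1)"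
  let ?p = "steps ?t (?c, \<sigma>)"
  have main: "halts_within (?t + 1 + T) (copies r M A (Suc m)) \<sigma>"
    "\<forall>cfg\<in>set_pmf (steps (?t + 1 + T) (copies r M A (Suc m), \<sigma>)).
           \<forall>j<M. Suc m \<le> j \<longrightarrow> snd cfg \<circ> copy r M j = \<sigma> \<circ> copy r M j"
    "measure_pmf.prob (steps (?t + 1 + T) (copies r M A (Suc m), \<sigma>))
           {cfg. \<exists>j<Suc m. snd cfg (copy r M j 2) [] \<noteq> b j}
         \<le> (\<Sum>j<Suc m. 1 - output_prob A (\<sigma> \<circ> copy r M j) (b j))"
    if assms: "Suc m \<le> M" "\<forall>j<Suc m. halts_within T A (\<sigma> \<circ> copy r M j)"
  proof -
    note m = prems[OF assms]
    note IH = Suc.IH[OF m(1,2)]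
    have same: "snd cfg \<circ> ?f = \<sigma> \<circ> ?f" if "cfg \<in> set_pmf ?p" for cfg
      using IH(2) that m(3) by blast
    have hA: "halts_within T A (\<sigma> \<circ> ?f)" using assms(2) by simp
    have h: "\<forall>cfg\<in>set_pmf ?p. halts_within T (rename ?f A) (snd cfg)"
      using same hA inj_copy[OF m(3)] by (auto intro!: halts_within_rename)
    show "halts_within (?t + 1 + T) (copies r M A (Suc m)) \<sigma>"
      unfolding copies.simps by (rule halts_within_Seq[OF IH(1) h])
    have st: "steps T (rename ?f A, snd cfg) =
        map_pmf (\<lambda>(c', \<tau>'). (rename ?f c', embed ?f (snd cfg) \<tau>')) (steps T (A, \<sigma> \<circ> ?f))"
      if "cfg \<in> set_pmf ?p" for cfg
      unfolding steps_rename_self[OF inj_copy[OF m(3)]] same[OF that] ..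
    have eq: "steps (?t + 1 + T) (copies r M A (Suc m), \<sigma>) =
        ?p \<bind> (\<lambda>cfg. steps T (rename ?f A, snd cfg))"
      unfolding copies.simps by (rule steps_Seq[OF IH(1) h])
    show "\<forall>cfg\<in>set_pmf (steps (?t + 1 + T) (copies r M A (Suc m), \<sigma>)).
           \<forall>j<M. Suc m \<le> j \<longrightarrow> snd cfg \<circ> copy r M j = \<sigma> \<circ> copy r M j"
    proof (intro ballI allI impI)
      fix cfg' j assume c': "cfg' \<in> set_pmf (steps (?t + 1 + T) (copies r M A (Suc m), \<sigma>))"
        and j: "j < M" "Suc m \<le> j"
      obtain cfg where cfg: "cfg \<in> set_pmf ?p" "cfg' \<in> set_pmf (steps T (rename ?f A, snd cfg))"
        using c' unfolding eq set_bind_pmf by blast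
      then obtain \<tau>' where "snd cfg' = embed ?f (snd cfg) \<tau>'"
        unfolding st[OF cfg(1)] by auto
      then have "snd cfg' \<circ> copy r M j = snd cfg \<circ> copy r M j"
        using j m(3) by (auto simp: fun_eq_iff embed_copy_other)
      also have "\<dots> = \<sigma> \<circ> copy r M j" using IH(2) cfg(1) j(1) Suc_leD[OF j(2)] by blast
      finally show "snd cfg' \<circ> copy r M j = \<sigma> \<circ> copy r M j" .
    qed
    let ?Bad = "{cfg :: com \<times> state. \<exists>j<m. snd cfg (copy r M j 2) [] \<noteq> b j}"
    let ?Bad' = "{cfg :: com \<times> state. \<exists>j<Suc m. snd cfg (copy r M j 2) [] \<noteq> b j}"
    let ?err = "1 - output_prob A (\<sigma> \<circ> ?f) (b m)"
    have out: "output_prob A (\<sigma> \<circ> ?f) (b m) =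
        measure_pmf.prob (steps T (A, \<sigma> \<circ> ?f)) {cfg. outputs cfg (b m)}"
      by (rule output_prob_eq[OF hA])
    have "measure_pmf.prob (steps (?t + 1 + T) (copies r M A (Suc m), \<sigma>)) ?Bad' =
        measure_pmf.expectation ?p (\<lambda>cfg. measure_pmf.prob (steps T (rename ?f A, snd cfg)) ?Bad')"
      unfolding eq by (intro prob_bind_finite finite_set_steps)
    also have "\<dots> \<le> measure_pmf.expectation ?p (\<lambda>cfg. indicator ?Bad cfg + ?err)"
    proof (intro integral_mono_AE integrable_measure_pmf_finite finite_set_steps)
      show "AE cfg in ?p. measure_pmf.prob (steps T (rename ?f A, snd cfg)) ?Bad' \<le>
          indicator ?Bad cfg + ?err"
        unfolding AE_measure_pmf_iff
      proof
        fix cfg assume cfg: "cfg \<in> set_pmf ?p"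
        show "measure_pmf.prob (steps T (rename ?f A, snd cfg)) ?Bad' \<le> indicator ?Bad cfg + ?err"
        proof (cases "cfg \<in> ?Bad")
          case True
          then have "indicator ?Bad cfg = (1 :: real)" by (simp only: indicator_simps)
          moreover have "0 \<le> ?err" unfolding out by simp
          moreover have "measure_pmf.prob (steps T (rename ?f A, snd cfg)) ?Bad' \<le> 1"
            by (rule measure_pmf.prob_le_1)
          ultimately show ?thesis by linarith
        next
          case False
          let ?g = "\<lambda>(c', \<tau>'). (rename ?f c', embed ?f (snd cfg) \<tau>')"
          \<comment> \<open>The earlier answers are right and cannot be altered any more, so a wrong
            answer must be that of copy \<open>m\<close>.\<close>
          have "?g -` ?Bad' \<subseteq> - {cfg. outputs cfg (b m)}"
          proof
            fix c assume "c \<in> ?g -` ?Bad'"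
            then obtain j where j: "j < Suc m" "embed ?f (snd cfg) (snd c) (copy r M j 2) [] \<noteq> b j"
              by (auto simp: case_prod_unfold)
            have "j = m"
            proof (rule ccontr)
              assume "j \<noteq> m"
              then show False using j False m(3) by (auto simp: embed_copy_other)
            qed
            then show "c \<in> - {cfg. outputs cfg (b m)}"
              using j(2) m(3) by (simp add: embed_copy_same outputs_def)
          qed
          then have "measure_pmf.prob (steps T (rename ?f A, snd cfg)) ?Bad' \<le>
              measure_pmf.prob (steps T (A, \<sigma> \<circ> ?f)) (- {cfg. outputs cfg (b m)})"
            unfolding st[OF cfg] measure_map_pmf
            by (intro measure_pmf.finite_measure_mono) auto
          also have "\<dots> = ?err" unfolding out
            using measure_pmf.prob_compl[of "{cfg. outputs cfg (b m)}" "steps T (A, \<sigma> \<circ> ?f)"]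
            by (simp add: Compl_eq_Diff_UNIV)
          finally show ?thesis using False by simp
        qed
      qed
    qed
    also have "\<dots> = measure_pmf.prob ?p ?Bad + ?err"
      by (subst Bochner_Integration.integral_add)
         (simp_all add: integrable_measure_pmf_finite finite_set_steps)
    also have "\<dots> \<le> (\<Sum>j<Suc m. 1 - output_prob A (\<sigma> \<circ> copy r M j) (b j))"
      using IH(3) by (simp only: sum.lessThan_Suc add_le_cancel_right)
    finally show "measure_pmf.prob (steps (?t + 1 + T) (copies r M A (Suc m), \<sigma>)) ?Bad' \<le>
        (\<Sum>j<Suc m. 1 - output_prob A (\<sigma> \<circ> copy r M j) (b j))" .
  qed
  have t: "Suc m * (T + 1) = ?t + 1 + T" by simp
  {
    case 1
    then show ?case unfolding t by (rule main(1))
  next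
    case 2
    then show ?case unfolding t by (rule main(2))
  next
    case 3
    then show ?case unfolding t by (rule main(3))
  }
qed

text \<open>Runs of exactly \<open>T\<close> steps in the separate copies can be chained; this is
  the lower bound matching the first claim of \<open>copies_spec\<close>.\<close>

lemma copies_reach:
  assumes "m \<le> M" "\<forall>j<m. \<exists>\<tau>. reach A (\<sigma> \<circ> copy r M j) T \<tau>"
  shows "\<exists>\<tau>. reach (copies r M A m) \<sigma> (m * (T + 1)) \<tau> \<and>
    (\<forall>j<M. m \<le> j \<longrightarrow> \<tau> \<circ> copy r M j = \<sigma> \<circ> copy r M j)"
  using assms
proof (induction m)
  case 0
  show ?case by (auto intro: reach_Skip)
next
  case (Suc m)
  then have "m \<le> M" "\<forall>j<m. \<exists>\<tau>. reach A (\<sigma> \<circ> copy r M j) T \<tau>"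
    using less_SucI Suc_leD by blast+
  then obtain \<tau> where \<tau>: "reach (copies r M A m) \<sigma> (m * (T + 1)) \<tau>"
    "\<forall>j<M. m \<le> j \<longrightarrow> \<tau> \<circ> copy r M j = \<sigma> \<circ> copy r M j" using Suc.IH by blast
  have m: "m < M" using Suc.prems(1) by simp
  then have same: "\<tau> \<circ> copy r M m = \<sigma> \<circ> copy r M m" using \<tau>(2) by simp
  obtain \<tau>' where "reach A (\<sigma> \<circ> copy r M m) T \<tau>'" using Suc.prems(2) lessI by blast
  then have "reach (rename (copy r M m) A) (embed (copy r M m) \<tau> (\<tau> \<circ> copy r M m)) T
      (embed (copy r M m) \<tau> \<tau>')"
    unfolding same by (rule reach_rename[OF inj_copy[OF m]])
  then have "reach (rename (copy r M m) A) \<tau> T (embed (copy r M m) \<tau> \<tau>')"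
    by (simp only: embed_self[OF inj_copy[OF m]])
  with \<tau>(1) have "reach (copies r M A (Suc m)) \<sigma> (m * (T + 1) + 1 + T) (embed (copy r M m) \<tau> \<tau>')"
    unfolding copies.simps by (rule reach_Seq)
  moreover have "embed (copy r M m) \<tau> \<tau>' \<circ> copy r M j = \<sigma> \<circ> copy r M j" if "j < M" "Suc m \<le> j" for j
    using that m \<tau>(2) by (auto simp: fun_eq_iff embed_copy_other)
  moreover have "Suc m * (T + 1) = m * (T + 1) + 1 + T" by simp
  ultimately show ?case by metis
qed

lemma foldr_xor_nat_sum:
  "(\<forall>x\<in>set xs. x < 2) \<Longrightarrow> foldr xor_nat xs 0 = sum_list xs mod 2"
proof (induction xs)
  case (Cons x xs)
  have "xor_nat x y = (x + y) mod 2" if "y < 2" for y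
    using that Cons.prems by (auto simp: less_2_cases_iff xor_nat_def)
  then have "foldr xor_nat (x # xs) 0 = (x + sum_list xs mod 2) mod 2"
    using Cons by simp
  also have "\<dots> = sum_list (x # xs) mod 2" by (simp add: mod_add_right_eq)
  finally show ?case .
qed simp

definition combine :: "nat \<Rightarrow> nat \<Rightarrow> com \<Rightarrow> com" where
  "combine r M A = Seq (copies r M A M)
     (Assign 2 [] (xor_list_exp (map (\<lambda>j. Read (copy r M j 2) []) [0..<M])))"

lemma combine_spec:
  assumes "\<forall>j<M. halts_within T A (\<sigma> \<circ> copy r M j)" "\<forall>j<M. b j < 2"
  shows "halts_within (M * (T + 1) + 1 + 1) (combine r M A) \<sigma>"
    and "1 - (\<Sum>j<M. 1 - output_prob A (\<sigma> \<circ> copy r M j) (b j)) \<le>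
      measure_pmf.prob (steps (M * (T + 1) + 1 + 1) (combine r M A, \<sigma>))
        {cfg. outputs cfg ((\<Sum>j<M. b j) mod 2)}"
proof -
  let ?a = "Assign 2 [] (xor_list_exp (map (\<lambda>j. Read (copy r M j 2) []) [0..<M]))"
  let ?p = "steps (M * (T + 1)) (copies r M A M, \<sigma>)"
  note spec = copies_spec[OF order_refl assms(1)]
  have h: "\<forall>cfg\<in>set_pmf ?p. halts_within 1 ?a (snd cfg)"
    using halts_within_Suc[of 0] by simp
  show "halts_within (M * (T + 1) + 1 + 1) (combine r M A) \<sigma>"
    unfolding combine_def by (rule halts_within_Seq[OF spec(1) h])
  let ?g = "\<lambda>cfg :: com \<times> state. (Skip, store (snd cfg) 2 []
      (eval (xor_list_exp (map (\<lambda>j. Read (copy r M j 2) []) [0..<M])) (snd cfg)))"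
  have eq: "steps (M * (T + 1) + 1 + 1) (combine r M A, \<sigma>) = map_pmf ?g ?p"
    unfolding combine_def steps_Seq[OF spec(1) h] map_pmf_def
    by (simp add: bind_return_pmf)
  let ?Bad = "{cfg :: com \<times> state. \<exists>j<M. snd cfg (copy r M j 2) [] \<noteq> b j}"
  have "- ?Bad \<subseteq> ?g -` {cfg. outputs cfg ((\<Sum>j<M. b j) mod 2)}"
  proof
    fix cfg assume "cfg \<in> - ?Bad"
    then have good: "snd cfg (copy r M j 2) [] = b j" if "j < M" for j using that by simp
    have "map (\<lambda>e. eval e (snd cfg)) (map (\<lambda>j. Read (copy r M j 2) []) [0..<M]) = map b [0..<M]"
      using good by simp
    moreover have "foldr xor_nat (map b [0..<M]) 0 = (\<Sum>j<M. b j) mod 2"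
      using assms(2) by (subst foldr_xor_nat_sum)
        (auto simp: sum_list_distinct_conv_sum_set atLeast0LessThan)
    ultimately show "cfg \<in> ?g -` {cfg. outputs cfg ((\<Sum>j<M. b j) mod 2)}"
      by (simp add: eval_xor_list_exp outputs_def halted_def store_def del: map_map)
  qed
  then have "measure_pmf.prob ?p (- ?Bad) \<le>
      measure_pmf.prob (steps (M * (T + 1) + 1 + 1) (combine r M A, \<sigma>))
        {cfg. outputs cfg ((\<Sum>j<M. b j) mod 2)}"
    unfolding eq measure_map_pmf by (intro measure_pmf.finite_measure_mono) auto
  moreover have "measure_pmf.prob ?p (- ?Bad) = 1 - measure_pmf.prob ?p ?Bad"
    using measure_pmf.prob_compl[of ?Bad ?p] by (simp add: Compl_eq_Diff_UNIV)
  ultimately show "1 - (\<Sum>j<M. 1 - output_prob A (\<sigma> \<circ> copy r M j) (b j)) \<le>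
      measure_pmf.prob (steps (M * (T + 1) + 1 + 1) (combine r M A, \<sigma>))
        {cfg. outputs cfg ((\<Sum>j<M. b j) mod 2)}"
    using spec(3)[of b] by linarith
qed

lemma combine_reach:
  assumes "\<forall>j<M. \<exists>\<tau>. reach A (\<sigma> \<circ> copy r M j) T \<tau>"
  shows "\<exists>\<tau>. reach (combine r M A) \<sigma> (M * (T + 1) + 1 + 1) \<tau>"
proof -
  obtain \<tau> where "reach (copies r M A M) \<sigma> (M * (T + 1)) \<tau>"
    using copies_reach[OF order_refl assms] by blast
  moreover have "\<exists>\<tau>'. reach (Assign x js e) \<tau> 1 \<tau>'" for x js e
    using runs_Assign[of x js e \<tau>] by (auto simp: runs_def)
  ultimately show ?thesis unfolding combine_def by (blast intro: reach_Seq)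
qed

section \<open>The worst-case solver\<close>

definition directions :: "nat \<Rightarrow> nat list list" where
  "directions d = filter (\<lambda>I. I \<noteq> []) (List.subseqs [0..<d])"

lemma set_directions: "set ` set (directions d) = Pow {..<d} - {{}}"
proof -
  have "set ` set (directions d) = set ` set (List.subseqs [0..<d]) - {{}}"
    by (auto simp: directions_def)
  then show ?thesis by (simp add: subseqs_powset atLeast0LessThan)
qed

lemma distinct_map_set_directions: "distinct (map set (directions d))"
  unfolding directions_def using distinct_set_subseqs[of "[0..<d]"]
  by (simp add: distinct_map_filter)

lemma length_directions: "length (directions d) < 2 ^ d"
proof -
  have "[] \<in> set (List.subseqs [0..<d])"
    using subset_subseqs[of "{}" "[0..<d]"] by auto
  then have "length (directions d) < length (List.subseqs [0..<d])"
    unfolding directions_def by (rule length_filter_less) simp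
  then show ?thesis by (simp add: length_subseqs)
qed

lemma nth_directions:
  assumes "j < length (directions d)"
  shows "distinct (directions d ! j)" "directions d ! j \<noteq> []" "set (directions d ! j) \<subseteq> {..<d}"
proof -
  have I: "directions d ! j \<in> set (directions d)" using assms by simp
  then show "distinct (directions d ! j)" "directions d ! j \<noteq> []"
    using subseqs_distinctD by (force simp: directions_def)+
  show "set (directions d ! j) \<subseteq> {..<d}" using I set_directions by blast
qed

lemma sum_directions:
  "(\<Sum>j<length (directions d). f (set (directions d ! j))) = (\<Sum>S\<in>Pow {..<d} - {{}}. f S)"
  for f :: "nat set \<Rightarrow> nat"
proof -
  have "(\<Sum>j<length (directions d). f (set (directions d ! j))) =
      sum_list (map f (map set (directions d)))"
    by (simp add: sum_list_sum_nth atLeast0LessThan)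
  also have "\<dots> = sum f (set (map set (directions d)))"
    using distinct_map_set_directions by (rule sum_list_distinct_conv_sum_set)
  finally show ?thesis by (simp add: set_directions)
qed

text \<open>Over all index sets the clique counts have an even sum, and the empty index set
  contributes the count of \<open>E\<close> itself; the remaining terms therefore have the parity of
  that count.\<close>

lemma parity_perturbations:
  assumes E: "E \<in> hypergraphs s n" and d: "k choose s < d"
  shows "(\<Sum>j<length (directions d).
      parity_clique k s n (sym_diff E (perturbation s n (directions d ! j) w))) mod 2 =
    parity_clique k s n E"
proof -
  let ?Y = "\<lambda>S. {e \<in> nsets {..<n} s. odd (card {i\<in>S. w (i, sorted_list_of_set e)})}"
  let ?c = "\<lambda>S. card (cliques k s n (sym_diff E (?Y S)))"
  let ?M = "length (directions d)"
  have pert: "perturbation s n (directions d ! j) w = ?Y (set (directions d ! j))" if "j < ?M" for j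
    using nth_directions(1)[OF that] unfolding perturbation_def
    by (simp add: distinct_length_filter Int_def conj_commute)
  have "(\<Sum>j<?M. parity_clique k s n (sym_diff E (perturbation s n (directions d ! j) w))) mod 2 =
      (\<Sum>j<?M. ?c (set (directions d ! j)) mod 2) mod 2"
    by (intro arg_cong[where f = "\<lambda>x. x mod 2"] sum.cong refl) (simp only: pert lessThan_iff parity_clique_def)
  also have "\<dots> = (\<Sum>S\<in>Pow {..<d} - {{}}. ?c S) mod 2"
    unfolding mod_sum_eq by (subst sum_directions) (rule refl)
  also have "\<dots> = ?c {} mod 2"
  proof -
    have "even (\<Sum>S\<in>Pow {..<d}. ?c S)" by (rule even_sum_cliques[OF E d])
    then have "even (?c {} + (\<Sum>S\<in>Pow {..<d} - {{}}. ?c S))"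
      by (subst (asm) sum.remove[where x = "{}"]) (simp_all only: finite_Pow_iff finite_lessThan Pow_bottom)
    then show ?thesis by presburger
  qed
  finally show ?thesis by (simp add: parity_clique_def)
qed

definition solver :: "nat \<Rightarrow> nat \<Rightarrow> com \<Rightarrow> com" where
  "solver s d A = Seq (sampler s d (directions d)) (combine (3 + s + d) (length (directions d)) A)"

definition solver_time :: "nat \<Rightarrow> nat \<Rightarrow> nat \<Rightarrow> nat \<Rightarrow> nat" where
  "solver_time s d n T = sampler_time s d (length (directions d)) n + 1 +
     (length (directions d) * (T + 1) + 1 + 1)"

lemma perturbed_hypergraph:
  "E \<in> hypergraphs s n \<Longrightarrow> sym_diff E (perturbation s n I w) \<in> hypergraphs s n"
  unfolding hypergraphs_def perturbation_def by blast

lemma runs_sampler_input: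
  "runs (sampler s d (directions d)) (input s n E) (sampler_time s d (length (directions d)) n)
    (map_pmf (prepared s d (directions d) n (input s n E)) (fair_bits ({..<d} \<times> words s n)))"
  by (rule runs_sampler) (auto simp: set_directions input_def)

lemma prepared_directions:
  "j < length (directions d) \<Longrightarrow> E \<in> hypergraphs s n \<Longrightarrow>
   prepared s d (directions d) n (input s n E) w \<circ> copy (3 + s + d) (length (directions d)) j =
    input s n (sym_diff E (perturbation s n (directions d ! j) w))"
  by (rule prepared_copy) (auto simp: set_directions)

lemma finite_set_fair_bits: "finite Z \<Longrightarrow> finite (set_pmf (fair_bits Z))"
  unfolding fair_bits_def by (rule finite_subset[OF set_Pi_pmf_subset']) auto

lemma prepared_halts_within:
  assumes "E \<in> hypergraphs s n" "\<And>G. G \<in> hypergraphs s n \<Longrightarrow> halts_within T A (input s n G)"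
  shows "\<forall>j<length (directions d). halts_within T A
    (prepared s d (directions d) n (input s n E) w \<circ> copy (3 + s + d) (length (directions d)) j)"
  using assms by (simp add: prepared_directions perturbed_hypergraph del: Un_iff)

lemma solver_steps:
  assumes E: "E \<in> hypergraphs s n"
    and halts: "\<And>G. G \<in> hypergraphs s n \<Longrightarrow> halts_within T A (input s n G)"
  shows "halts_within (solver_time s d n T) (solver s d A) (input s n E)"
    and "steps (solver_time s d n T) (solver s d A, input s n E) =
      fair_bits ({..<d} \<times> words s n) \<bind> (\<lambda>w. steps (length (directions d) * (T + 1) + 1 + 1)
        (combine (3 + s + d) (length (directions d)) A, prepared s d (directions d) n (input s n E) w))"
proof -
  let ?Ls = "directions d" and ?M = "length (directions d)" and ?r = "3 + s + d"
  let ?S = "sampler_time s d ?M n" and ?t = "?M * (T + 1) + 1 + 1"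
  let ?W = "fair_bits ({..<d} \<times> words s n)"
  let ?st = "prepared s d ?Ls n (input s n E)"
  let ?C = "combine ?r ?M A"
  have sampler: "steps ?S (sampler s d ?Ls, input s n E) = map_pmf (\<lambda>w. (Skip, ?st w)) ?W"
    using runs_sampler_input[of s d n E] by (simp add: runs_def pmf.map_comp o_def)
  have hS: "halts_within ?S (sampler s d ?Ls) (input s n E)"
    using runs_sampler_input by (rule runs_halts_within)
  have hA: "\<forall>j<?M. halts_within T A (?st w \<circ> copy ?r ?M j)" for w
    by (rule prepared_halts_within[OF E halts])
  have hC: "halts_within ?t ?C (?st w)" for w
    using combine_spec(1)[OF hA, where b = "\<lambda>_. 0"] by simp
  have hC': "\<forall>cfg\<in>set_pmf (steps ?S (sampler s d ?Ls, input s n E)). halts_within ?t ?C (snd cfg)"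
    unfolding sampler using hC by auto
  show "halts_within (solver_time s d n T) (solver s d A) (input s n E)"
    unfolding solver_def solver_time_def by (rule halts_within_Seq[OF hS hC'])
  show "steps (solver_time s d n T) (solver s d A, input s n E) =
      ?W \<bind> (\<lambda>w. steps ?t (?C, ?st w))"
    unfolding solver_def solver_time_def steps_Seq[OF hS hC'] sampler bind_map_pmf by simp
qed

text \<open>For fixed directions the error is at most the sum of the errors of \<open>A\<close> at
  the perturbed points. In expectation over the directions each summand is the average-case error,
  because each point by itself is uniform.\<close>

lemma solver_error:
  assumes E: "E \<in> hypergraphs s n" and d: "k choose s < d"
    and halts: "\<And>G. G \<in> hypergraphs s n \<Longrightarrow> halts_within T A (input s n G)"
  shows "error_prob k s (solver s d A) n E \<le> real (length (directions d)) *
      measure_pmf.expectation (random_hypergraph n (1/2) s) (error_prob k s A n)"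
proof -
  let ?Ls = "directions d" and ?M = "length (directions d)" and ?r = "3 + s + d"
  let ?t = "?M * (T + 1) + 1 + 1"
  let ?W = "fair_bits ({..<d} \<times> words s n)"
  let ?st = "prepared s d ?Ls n (input s n E)"
  let ?G = "\<lambda>j w. sym_diff E (perturbation s n (?Ls ! j) w)"
  let ?b = "\<lambda>w j. parity_clique k s n (?G j w)"
  let ?C = "combine ?r ?M A"
  have fin: "finite (set_pmf ?W)"
    by (intro finite_set_fair_bits finite_cartesian_product) (simp_all add: finite_words)
  have steps: "steps (solver_time s d n T) (solver s d A, input s n E) = ?W \<bind> (\<lambda>w. steps ?t (?C, ?st w))"
    by (rule solver_steps(2)[OF E halts])
  have good: "1 - (\<Sum>j<?M. error_prob k s A n (?G j w)) \<le>
      measure_pmf.prob (steps ?t (?C, ?st w)) {cfg. outputs cfg (parity_clique k s n E)}" for w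
  proof -
    have "1 - (\<Sum>j<?M. 1 - output_prob A (?st w \<circ> copy ?r ?M j) (?b w j)) \<le>
      measure_pmf.prob (steps ?t (?C, ?st w)) {cfg. outputs cfg ((\<Sum>j<?M. ?b w j) mod 2)}"
      by (rule combine_spec(2)[OF prepared_halts_within[OF E halts]]) (simp_all add: parity_clique_def)
    moreover have "(\<Sum>j<?M. 1 - output_prob A (?st w \<circ> copy ?r ?M j) (?b w j)) =
        (\<Sum>j<?M. error_prob k s A n (?G j w))"
      by (intro sum.cong refl) (simp only: error_prob_def prepared_directions[OF _ E] lessThan_iff)
    ultimately show ?thesis by (simp only: parity_perturbations[OF E d])
  qed
  have "measure_pmf.expectation ?W (\<lambda>w. 1 - (\<Sum>j<?M. error_prob k s A n (?G j w))) \<le>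
      measure_pmf.expectation ?W (\<lambda>w. measure_pmf.prob (steps ?t (?C, ?st w))
        {cfg. outputs cfg (parity_clique k s n E)})"
    using fin good by (intro integral_mono_AE integrable_measure_pmf_finite) simp_all
  also have "\<dots> = measure_pmf.prob (steps (solver_time s d n T) (solver s d A, input s n E))
      {cfg. outputs cfg (parity_clique k s n E)}"
    unfolding steps by (intro prob_bind_finite [symmetric] fin finite_set_steps)
  also have "\<dots> \<le> output_prob (solver s d A) (input s n E) (parity_clique k s n E)"
    by (rule output_prob_ge)
  finally have le: "error_prob k s (solver s d A) n E \<le>
      1 - measure_pmf.expectation ?W (\<lambda>w. 1 - (\<Sum>j<?M. error_prob k s A n (?G j w)))"
    by (simp add: error_prob_def)
  have "measure_pmf.expectation ?W (\<lambda>w. 1 - (\<Sum>j<?M. error_prob k s A n (?G j w))) =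
      1 - (\<Sum>j<?M. measure_pmf.expectation ?W (\<lambda>w. error_prob k s A n (?G j w)))"
    using fin by (simp add: integrable_measure_pmf_finite Bochner_Integration.integral_diff
        Bochner_Integration.integral_sum)
  also have "(\<Sum>j<?M. measure_pmf.expectation ?W (\<lambda>w. error_prob k s A n (?G j w))) =
      (\<Sum>j<?M. measure_pmf.expectation (random_hypergraph n (1/2) s) (error_prob k s A n))"
  proof (intro sum.cong refl)
    fix j assume "j \<in> {..<?M}"
    then have j: "j < ?M" by simp
    have "random_hypergraph n (1/2) s = map_pmf (?G j) ?W"
      using nth_directions[OF j] E by (rule perturbed_uniform [symmetric])
    then show "measure_pmf.expectation ?W (\<lambda>w. error_prob k s A n (?G j w)) =
        measure_pmf.expectation (random_hypergraph n (1/2) s) (error_prob k s A n)"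
      by (simp only: integral_map_pmf)
  qed
  finally show "error_prob k s (solver s d A) n E \<le> real ?M *
      measure_pmf.expectation (random_hypergraph n (1/2) s) (error_prob k s A n)"
    using le by simp
qed

lemma solver_reach:
  assumes E: "E \<in> hypergraphs s n" and r: "reach A (input s n E) T \<tau>"
  shows "\<exists>\<tau>. reach (solver s d A) (input s n E) (solver_time s d n T) \<tau>"
proof -
  \<comment> \<open>The outcome in which all bits are 0 has positive probability and hands
    \<open>E\<close> to every copy.\<close>
  let ?st = "prepared s d (directions d) n (input s n E) (\<lambda>_. False)"
  have "(\<lambda>_. False) \<in> set_pmf (fair_bits ({..<d} \<times> words s n))"
    unfolding fair_bits_def by (subst set_Pi_pmf) (auto simp: finite_words PiE_dflt_def)
  then have "?st \<in> set_pmf (map_pmf (prepared s d (directions d) n (input s n E))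
      (fair_bits ({..<d} \<times> words s n)))" by simp
  then have S: "reach (sampler s d (directions d)) (input s n E)
      (sampler_time s d (length (directions d)) n) ?st"
    using runs_sampler_input unfolding runs_def by blast
  have "perturbation s n I (\<lambda>_. False) = {}" for I by (simp add: perturbation_def)
  then have "\<forall>j<length (directions d). \<exists>\<tau>.
      reach A (?st \<circ> copy (3 + s + d) (length (directions d)) j) T \<tau>"
    using prepared_directions[OF _ E, of _ d "\<lambda>_. False"] r by auto
  from combine_reach[OF this] S show ?thesis
    unfolding solver_def solver_time_def by (blast intro: reach_Seq)
qed

lemma runtime_halts_within:
  assumes "runtime s A n = enat T" "E \<in> hypergraphs s n"
  shows "halts_within T A (input s n E)"
  using SUP_upper[OF assms(2), of "\<lambda>E. time A (input s n E)"] assms(1)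
  by (simp add: runtime_def flip: time_le_iff)

text \<open>There are only finitely many inputs of a given size, so the supremum is a
  maximum.\<close>

lemma runtime_attained:
  assumes "runtime s A n = enat T"
  shows "\<exists>E\<in>hypergraphs s n. time A (input s n E) = enat T"
proof -
  let ?X = "(\<lambda>E. time A (input s n E)) ` hypergraphs s n"
  have "finite ?X" "?X \<noteq> {}" by (simp_all add: finite_hypergraphs) (auto simp: hypergraphs_def)
  then have "Max ?X \<in> ?X" "Sup ?X = Max ?X" by (simp_all add: Sup_enat_def)
  then show ?thesis using assms by (auto simp: runtime_def)
qed

text \<open>
  The running time is determined exactly, because the hypothesis on worst-case algorithms applies only
  to programs with monotone running time. The worst case is attained when all directions are empty:
  then every copy receives the worst input of \<open>A\<close>.
\<close>

lemma runtime_solver: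
  assumes T: "runtime s A n = enat T"
  shows "runtime s (solver s d A) n = enat (solver_time s d n T)"
proof (rule antisym)
  show "runtime s (solver s d A) n \<le> enat (solver_time s d n T)"
    unfolding runtime_def
  proof (rule SUP_least)
    fix E assume "E \<in> hypergraphs s n"
    then show "time (solver s d A) (input s n E) \<le> enat (solver_time s d n T)"
      unfolding time_le_iff using runtime_halts_within[OF T] by (intro solver_steps(1))
  qed
  obtain E where E: "E \<in> hypergraphs s n" "time A (input s n E) = enat T"
    using runtime_attained[OF T] by blast
  obtain \<tau> where "reach (solver s d A) (input s n E) (solver_time s d n T) \<tau>"
    using reach_of_time[OF E(2)] solver_reach[OF E(1)] by blast
  then have "enat (solver_time s d n T) \<le> time (solver s d A) (input s n E)" by (rule reach_time)
  also have "\<dots> \<le> runtime s (solver s d A) n" unfolding runtime_def by (rule SUP_upper[OF E(1)])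
  finally show "enat (solver_time s d n T) \<le> runtime s (solver s d A) n" .
qed

section \<open>Running-time estimates\<close>

lemma nest_time_mono: "n \<le> n' \<Longrightarrow> nest_time T n m \<le> nest_time T n' m"
  by (induction m) (auto intro!: mult_le_mono)

lemma solver_time_mono:
  assumes "n \<le> n'" "T \<le> T'"
  shows "solver_time s d n T \<le> solver_time s d n' T'"
  unfolding solver_time_def sampler_time_def
  using assms by (intro add_mono mult_le_mono nest_time_mono) simp_all

text \<open>The overhead \<open>4 * n + 3\<close> of a level is at most
  \<open>7 * n ^ Suc m\<close>.\<close>

lemma nest_time_le:
  assumes "1 \<le> n"
  shows "nest_time T n m \<le> (T + 7 * m) * n ^ m"
proof (induction m)
  case (Suc m)
  have "nest_time T n (Suc m) \<le> n * ((T + 7 * m) * n ^ m + 4) + 3" using Suc by simp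
  also have "\<dots> \<le> n * ((T + 7 * m) * n ^ m) + 7 * n" using assms by (simp add: algebra_simps)
  also have "\<dots> \<le> n * ((T + 7 * m) * n ^ m) + 7 * n ^ Suc m" using assms by simp
  also have "\<dots> = (T + 7 * Suc m) * n ^ Suc m" by (simp add: algebra_simps)
  finally show ?case .
qed simp

lemma solver_time_le:
  assumes n: "1 \<le> n"
  shows "solver_time s d n T \<le>
    (2 * d + 5 * length (directions d) + 14 * s + 5) * n ^ s + length (directions d) * T"
proof -
  let ?M = "length (directions d)"
  have "1 \<le> n ^ s" using n by simp
  \<comment> \<open>The cost outside the loops: \<open>2 * ?M\<close> for the sizes,
    \<open>?M\<close> sequencing steps between the copies, four further sequencing steps and the
    final assignment.\<close>
  then have "(3 * ?M + 5) * 1 \<le> (3 * ?M + 5) * n ^ s" by (rule mult_le_mono2)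
  moreover have "nest_time (2 * d) n s \<le> (2 * d + 7 * s) * n ^ s"
    "nest_time (2 * ?M) n s \<le> (2 * ?M + 7 * s) * n ^ s" by (rule nest_time_le[OF n])+
  moreover have "(2 * d + 5 * ?M + 14 * s + 5) * n ^ s =
      (2 * d + 7 * s) * n ^ s + (2 * ?M + 7 * s) * n ^ s + (3 * ?M + 5) * n ^ s"
    by (simp add: algebra_simps)
  ultimately show ?thesis
    unfolding solver_time_def sampler_time_def by (simp add: algebra_simps)
qed

lemma eventually_le_powr:
  fixes a x :: real
  assumes "0 < a" "0 < x"
  shows "\<forall>\<^sub>F n in sequentially. x \<le> real n powr a"
proof (rule eventually_sequentiallyI[of "nat \<lceil>x powr (1 / a)\<rceil>"])
  fix n assume "nat \<lceil>x powr (1 / a)\<rceil> \<le> n"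
  then have "(x powr (1 / a)) powr a \<le> real n powr a"
    using assms(1) by (intro powr_mono2) (simp_all add: nat_ceiling_le_eq)
  then show "x \<le> real n powr a" using assms by (simp add: powr_powr)
qed

text \<open>The order of the quantifiers makes the exponent uniform: \<open>c'\<close> is chosen
  from \<open>c\<close> alone, before \<open>k\<close> and \<open>s\<close>.\<close>

theorem corollary2p12:
  "\<exists>\<epsilon> :: nat \<Rightarrow> nat \<Rightarrow> real.
     (\<forall>k s. 2 \<le> s \<and> s \<le> k \<longrightarrow> 0 < \<epsilon> k s) \<and>
     (\<forall>c > 0. \<exists>c' > 0. \<forall>k s. 2 \<le> s \<and> s \<le> k \<longrightarrow>
        (\<forall>B. mono (runtime s B) \<and> worst_case_error_less k s B (1/3)
           \<longrightarrow> time_at_least (runtime s B) (c * real k)) \<longrightarrow>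
        (\<forall>A. mono (runtime s A) \<and> average_case_error_less k s A (\<epsilon> k s)
           \<longrightarrow> time_at_least (runtime s A) (c' * real k)))"
proof (intro exI[of _ "\<lambda>k s. 1 / (3 * 2 ^ ((k choose s) + 1))"] conjI allI impI)
  fix c :: real assume c: "0 < c"
  show "\<exists>c' > 0. \<forall>k s. 2 \<le> s \<and> s \<le> k \<longrightarrow>
        (\<forall>B. mono (runtime s B) \<and> worst_case_error_less k s B (1/3)
           \<longrightarrow> time_at_least (runtime s B) (c * real k)) \<longrightarrow>
        (\<forall>A. mono (runtime s A) \<and> average_case_error_less k s A (1 / (3 * 2 ^ ((k choose s) + 1)))
           \<longrightarrow> time_at_least (runtime s A) (c' * real k))"
  \<comment> \<open>Half of the exponent pays for a constant factor that depends on \<open>A\<close>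
    through \<open>read_bound A\<close>, so no fixed constant could replace it.\<close>
  proof (intro exI[of _ "c / 2"] conjI allI impI; (elim conjE)?)
    fix k s A
    assume s: "2 \<le> s" "s \<le> k"
      and hard: "\<forall>B. mono (runtime s B) \<and> worst_case_error_less k s B (1/3)
           \<longrightarrow> time_at_least (runtime s B) (c * real k)"
      and mono: "mono (runtime s A)"
      and avg: "average_case_error_less k s A (1 / (3 * 2 ^ ((k choose s) + 1)))"
    show "time_at_least (runtime s A) (c / 2 * real k)"
    proof (cases "\<exists>N. runtime s A N = \<infinity>")
      \<comment> \<open>An infinite running time at one size persists at all larger sizes by
        monotonicity.\<close>
      case True
      then obtain N where "runtime s A N = \<infinity>" by blast
      then have "runtime s A n = \<infinity>" if "N \<le> n" for n
        using monoD[OF mono that] by simp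
      then show ?thesis
        unfolding time_at_least_def by (intro eventually_sequentiallyI[of N]) simp
    next
      case False
      define T where "T n = the_enat (runtime s A n)" for n
      have T: "runtime s A n = enat (T n)" for n
      proof -
        have "runtime s A n \<noteq> \<infinity>" using False by (simp only: not_ex simp_thms)
        then obtain i where "runtime s A n = enat i" by auto
        then show ?thesis by (simp add: T_def)
      qed
      have halts: "halts_within (T n) A (input s n E)" if "E \<in> hypergraphs s n" for n E
        using runtime_halts_within[OF T that] .
      \<comment> \<open>One direction more than the degree of the clique polynomial.\<close>
      define d where "d = (k choose s) + 1"
      define M where "M = length (directions d)"
      let ?B = "solver s d A"
      let ?err = "\<lambda>n. measure_pmf.expectation (random_hypergraph n (1/2) s) (error_prob k s A n)"
      have err: "?err n < 1 / (3 * 2 ^ d)" for n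
        using avg by (simp add: average_case_error_less_def d_def)
      have B: "runtime s ?B n = enat (solver_time s d n (T n))" for n
        by (rule runtime_solver[OF T])
      have "mono (runtime s ?B)"
      proof (rule monoI)
        fix n n' :: nat assume "n \<le> n'"
        moreover from this have "T n \<le> T n'" using monoD[OF mono] by (fastforce simp: T)
        ultimately show "runtime s ?B n \<le> runtime s ?B n'" by (simp add: B solver_time_mono)
      qed
      moreover have "worst_case_error_less k s ?B (1/3)"
        unfolding worst_case_error_less_def
      proof (intro allI ballI)
        fix n E assume E: "E \<in> hypergraphs s n"
        have "error_prob k s ?B n E \<le> real M * ?err n"
          unfolding M_def by (rule solver_error[OF E _ halts]) (simp_all add: d_def)
        also have "\<dots> \<le> real M * (1 / (3 * 2 ^ d))" using err[of n] by (intro mult_left_mono) simp_all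
        also have "\<dots> < real (2 ^ d) * (1 / (3 * 2 ^ d))"
          unfolding M_def
          by (intro mult_strict_right_mono of_nat_less_iff[THEN iffD2] length_directions) simp
        finally show "error_prob k s ?B n E < 1/3" by simp
      qed
      ultimately have "time_at_least (runtime s ?B) (c * real k)" using hard by blast
      then have lower: "\<forall>\<^sub>F n in sequentially. real n powr (c * real k) \<le> real (solver_time s d n (T n))"
        by (simp add: time_at_least_def B)
      \<comment> \<open>\<open>Q\<close> is the factor in the query bound
        \<open>n ^ s \<le> Q * T n\<close>, and \<open>K\<close> is the resulting slowdown of the
        solver relative to \<open>A\<close>.\<close>
      define Q where "Q = 2 ^ d * real k ^ k * real (read_bound A)"
      define K where "K = real (2 * d + 5 * M + 14 * s + 5) * Q + real M"
      have upper: "real (solver_time s d n (T n)) \<le> K * real (T n)" if n: "k \<le> n" for n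
      proof -
        have "?err n \<le> 1 / 2 ^ d" using err[of n] by (rule less_imp_le[OF less_le_trans]) (simp add: field_simps)
        then have Qn: "real n ^ s \<le> Q * real (T n)"
          unfolding Q_def d_def using s n halts by (intro query_lower_bound) simp_all
        have "1 \<le> n" using s n by simp
        then have "solver_time s d n (T n) \<le> (2 * d + 5 * M + 14 * s + 5) * n ^ s + M * T n"
          unfolding M_def by (rule solver_time_le)
        then have "real (solver_time s d n (T n)) \<le> real ((2 * d + 5 * M + 14 * s + 5) * n ^ s + M * T n)"
          by (rule of_nat_mono)
        also have "\<dots> = real (2 * d + 5 * M + 14 * s + 5) * real n ^ s + real M * real (T n)"
          by simp
        also have "\<dots> \<le> real (2 * d + 5 * M + 14 * s + 5) * (Q * real (T n)) + real M * real (T n)"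
          using Qn by (intro add_right_mono mult_left_mono) simp_all
        also have "\<dots> = K * real (T n)" by (simp add: K_def algebra_simps)
        finally show ?thesis .
      qed
      have pos: "0 < c / 2 * real k" using c s by simp
      \<comment> \<open>The maximum with 1 ensures a positive bound here and the positivity of
        \<open>?x\<close> below.\<close>
      have "\<forall>\<^sub>F n in sequentially. max K 1 \<le> real n powr (c / 2 * real k)"
        by (rule eventually_le_powr[OF pos]) simp
      with lower eventually_ge_at_top[of k]
      have "\<forall>\<^sub>F n in sequentially. real n powr (c / 2 * real k) \<le> real (T n)"
      proof eventually_elim
        case (elim n)
        let ?x = "real n powr (c / 2 * real k)"
        \<comment> \<open>Of the two factors \<open>?x\<close> in the lower bound for the solver,
          one outweighs \<open>K\<close> and the other remains for \<open>A\<close>.\<close>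
        have "?x * ?x = real n powr (c * real k)" by (simp flip: powr_add)
        then have "?x * ?x \<le> K * real (T n)" using elim upper[of n] by linarith
        also have "\<dots> \<le> ?x * real (T n)" using elim by (intro mult_right_mono) simp_all
        finally have "?x * ?x \<le> ?x * real (T n)" .
        moreover have "0 < ?x" using elim by linarith
        ultimately show ?case by (simp only: mult_le_cancel_left_pos)
      qed
      then show ?thesis by (simp add: time_at_least_def T)
    qed
  qed (use c in simp)
qed simp

end
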